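(* Let $\Omega\subset\mathbb{R}^n$ be a bounded open domain and $0<\alpha\le 1$. Assume that $f:\mathbb{R}\to\mathbb{R}$ is continuous and monotone non-decreasing, and that $g:\partial\Omega\to\mathbb{R}$ is continuous. Then the problem $$\begin{cases} L[u]=f(u) & \text{in } \Omega,\\ u=g & \text{on } \partial\Omega,\end{cases}$$ has a viscosity solution $u:\overline{\Omega}\to\mathbb{R}$ which is locally $\beta$-H\"older continuous in $\Omega$ for every $0<\beta<\alpha$. Moreover, for $0<\beta<\alpha$, one has $u\in C^{0,\beta}(\overline{\Omega})$ as soon as $g\in C^{0,\beta}(\partial\Omega)$. In addition, if $\alpha\in(0,1)$ and $f$ is nonnegative, then $u$ is locally $\alpha$-H\"older continuous in $\Omega$.
   Context: For $w:\overline{\Omega}\to\mathbb{R}$ and $x\in\Omega$ put $$L^+[w](x)=\sup_{y\in\overline{\Omega},\,y\ne x}\frac{w(y)-w(x)}{|y-x|^\alpha},\qquad L^-[w](x)=\inf_{y\in\overline{\Omega},\,y\ne x}\frac{w(y)-w(x)}{|y-x|^\alpha},\qquad L[w]=L^+[w]+L^-[w].$$ A function $u:\overline{\Omega}\to\mathbb{R}$ is a (viscosity) subsolution of $L[u]=f(u)$ in $\Omega$ if $u$ is upper semicontinuous on $\overline{\Omega}$ and for every $\varphi\in C^1(\Omega)\cap C(\overline{\Omega})$ with $u\le\varphi$ on $\overline{\Omega}$ and $u(x_0)=\varphi(x_0)$ at some $x_0\in\Omega$, one has $-L[\varphi](x_0)+f(\varphi(x_0))\le 0$. It is a (viscosity)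 supersolution if $u$ is lower semicontinuous on $\overline{\Omega}$ and for every $\varphi\in C^1(\Omega)\cap C(\overline{\Omega})$ with $u\ge\varphi$ on $\overline{\Omega}$ and $u(x_0)=\varphi(x_0)$ at some $x_0\in\Omega$, one has $-L[\varphi](x_0)+f(\varphi(x_0))\ge 0$. It is a viscosity solution if it is both a subsolution and a supersolution. "Locally $\gamma$-H\"older" means $\gamma$-H\"older continuous on every $\omega\subset\subset\Omega$. *)

theory Defs
  imports "HOL-Analysis.Analysis"
begin

text \<open>
  The supremum and infimum below are those of type \<^typ>\<open>real\<close>, hence only meaningful when
  the set of difference quotients is nonempty and bounded. This is the case for
  \<^term>\<open>0 < \<alpha>\<close>, \<^term>\<open>\<alpha> \<le> 1\<close>, a bounded open set
  \<^term>\<open>\<Omega>\<close>, a point \<^term>\<open>x \<in> \<Omega>\<close> and a function that is continuous on the closure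
  and differentiable at \<^term>\<open>x\<close> (lemma \<open>holder_quotients_bounded\<close> below),
  in particular for all the test functions to which the operator is applied.
\<close>

definition holder_quotients :: "real \<Rightarrow> (real ^ 'n::finite) set \<Rightarrow> (real ^ 'n \<Rightarrow> real) \<Rightarrow> real ^ 'n \<Rightarrow> real set"
  where "holder_quotients \<alpha> \<Omega> w x =
    {(w y - w x) / norm (y - x) powr \<alpha> | y. y \<in> closure \<Omega> \<and> y \<noteq> x}"

definition L_plus :: "real \<Rightarrow> (real ^ 'n::finite) set \<Rightarrow> (real ^ 'n \<Rightarrow> real) \<Rightarrow> real ^ 'n \<Rightarrow> real"
  where "L_plus \<alpha> \<Omega> w x = Sup (holder_quotients \<alpha> \<Omega> w x)"

definition L_minus :: "real \<Rightarrow> (real ^ 'n::finite) set \<Rightarrow> (real ^ 'n \<Rightarrow> real) \<Rightarrow> real ^ 'n \<Rightarrow> real"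
  where "L_minus \<alpha> \<Omega> w x = Inf (holder_quotients \<alpha> \<Omega> w x)"

definition L_op :: "real \<Rightarrow> (real ^ 'n::finite) set \<Rightarrow> (real ^ 'n \<Rightarrow> real) \<Rightarrow> real ^ 'n \<Rightarrow> real"
  where "L_op \<alpha> \<Omega> w x = L_plus \<alpha> \<Omega> w x + L_minus \<alpha> \<Omega> w x"

lemma holder_quotients_bounded:
  fixes \<Omega> :: "(real ^ 'n::finite) set"
  assumes "bounded \<Omega>" "open \<Omega>" "x \<in> \<Omega>" "0 < \<alpha>" "\<alpha> \<le> 1"
    and cont: "continuous_on (closure \<Omega>) w" and diff: "w differentiable (at x)"
  shows "holder_quotients \<alpha> \<Omega> w x \<noteq> {}" and "bounded (holder_quotients \<alpha> \<Omega> w x)"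
proof -
  obtain e where e: "e > 0" "ball x e \<subseteq> \<Omega>"
    using assms(2,3) by (meson open_contains_ball)
  have "x islimpt \<Omega>"
    using assms(2,3) by (simp add: interior_limit_point interior_open)
  then obtain y where "y \<in> \<Omega>" "y \<noteq> x"
    by (meson islimptE open_UNIV UNIV_I)
  then show "holder_quotients \<alpha> \<Omega> w x \<noteq> {}"
    unfolding holder_quotients_def using closure_subset by blast
  obtain w' where w': "(w has_derivative w') (at x)"
    using diff by (auto simp: differentiable_def)
  then obtain d where d: "d > 0"
    "\<And>y. norm (y - x) < d \<Longrightarrow> norm (w y - w x - w' (y - x)) \<le> 1 * norm (y - x)"
    unfolding has_derivative_at_alt by (metis zero_less_one)
  obtain K where K: "\<And>h. norm (w' h) \<le> norm h * K" "K > 0"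
    using has_derivative_bounded_linear[OF w'] bounded_linear.pos_bounded by blast
  define r where "r = min d 1"
  have r: "0 < r" "r \<le> 1" "r \<le> d" using d(1) by (auto simp: r_def)
  have "compact (w ` closure \<Omega>)"
    using assms(1) cont by (intro compact_continuous_image) (auto simp: compact_closure)
  then obtain M where M: "\<And>y. y \<in> closure \<Omega> \<Longrightarrow> \<bar>w y\<bar> \<le> M"
    by (metis bounded_iff compact_imp_bounded imageI real_norm_def)
  have x: "x \<in> closure \<Omega>" using assms(3) closure_subset by blast
  have "\<bar>(w y - w x) / norm (y - x) powr \<alpha>\<bar> \<le> max (1 + K) (2 * M / r powr \<alpha>)"
    if y: "y \<in> closure \<Omega>" "y \<noteq> x" for y
  proof (cases "norm (y - x) < r")
    case True
    have "\<bar>w y - w x\<bar> \<le> (1 + K) * norm (y - x)"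
      using d(2)[of y] K(1)[of "y - x"] True r by (auto simp: algebra_simps abs_le_iff)
    also have "norm (y - x) \<le> norm (y - x) powr \<alpha>"
      using powr_mono'[of \<alpha> 1 "norm (y - x)"] True r y assms(5) by auto
    finally have "\<bar>w y - w x\<bar> \<le> (1 + K) * norm (y - x) powr \<alpha>"
      using K(2) by (simp add: mult_left_mono)
    then show ?thesis
      using y by (simp add: field_simps le_max_iff_disj)
  next
    case False
    have "r powr \<alpha> \<le> norm (y - x) powr \<alpha>"
      using False r assms(4) by (intro powr_mono2) auto
    moreover have "\<bar>w y - w x\<bar> \<le> 2 * M"
      using M[OF y(1)] M[OF x] by (auto simp: abs_le_iff)
    ultimately have "\<bar>w y - w x\<bar> / norm (y - x) powr \<alpha> \<le> 2 * M / r powr \<alpha>"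
      using r by (intro frac_le) auto
    then show ?thesis by (simp add: le_max_iff_disj)
  qed
  then show "bounded (holder_quotients \<alpha> \<Omega> w x)"
    unfolding holder_quotients_def bounded_iff real_norm_def by blast
qed

definition usc_on :: "'a::topological_space set \<Rightarrow> ('a \<Rightarrow> real) \<Rightarrow> bool"
  where "usc_on S u \<longleftrightarrow> (\<forall>x\<in>S. \<forall>c>u x. \<forall>\<^sub>F y in at x within S. u y < c)"

definition lsc_on :: "'a::topological_space set \<Rightarrow> ('a \<Rightarrow> real) \<Rightarrow> bool"
  where "lsc_on S u \<longleftrightarrow> (\<forall>x\<in>S. \<forall>c<u x. \<forall>\<^sub>F y in at x within S. c < u y)"

definition C1_on :: "(real ^ 'n::finite) set \<Rightarrow> (real ^ 'n \<Rightarrow> real) \<Rightarrow> bool"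
  where "C1_on \<Omega> \<phi> \<longleftrightarrow> (\<exists>G. (\<forall>x\<in>\<Omega>. GDERIV \<phi> x :> G x) \<and> continuous_on \<Omega> G)"

definition viscosity_subsolution ::
    "real \<Rightarrow> (real ^ 'n::finite) set \<Rightarrow> (real \<Rightarrow> real) \<Rightarrow> (real ^ 'n \<Rightarrow> real) \<Rightarrow> bool"
  where "viscosity_subsolution \<alpha> \<Omega> f u \<longleftrightarrow>
    usc_on (closure \<Omega>) u \<and>
    (\<forall>\<phi> x0. C1_on \<Omega> \<phi> \<and> continuous_on (closure \<Omega>) \<phi> \<and>
       (\<forall>x\<in>closure \<Omega>. u x \<le> \<phi> x) \<and> x0 \<in> \<Omega> \<and> u x0 = \<phi> x0
       \<longrightarrow> - L_op \<alpha> \<Omega> \<phi> x0 + f (\<phi> x0) \<le> 0)"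

definition viscosity_supersolution ::
    "real \<Rightarrow> (real ^ 'n::finite) set \<Rightarrow> (real \<Rightarrow> real) \<Rightarrow> (real ^ 'n \<Rightarrow> real) \<Rightarrow> bool"
  where "viscosity_supersolution \<alpha> \<Omega> f u \<longleftrightarrow>
    lsc_on (closure \<Omega>) u \<and>
    (\<forall>\<phi> x0. C1_on \<Omega> \<phi> \<and> continuous_on (closure \<Omega>) \<phi> \<and>
       (\<forall>x\<in>closure \<Omega>. u x \<ge> \<phi> x) \<and> x0 \<in> \<Omega> \<and> u x0 = \<phi> x0
       \<longrightarrow> - L_op \<alpha> \<Omega> \<phi> x0 + f (\<phi> x0) \<ge> 0)"

definition viscosity_solution ::
    "real \<Rightarrow> (real ^ 'n::finite) set \<Rightarrow> (real \<Rightarrow> real) \<Rightarrow> (real ^ 'n \<Rightarrow> real) \<Rightarrow> bool"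
  where "viscosity_solution \<alpha> \<Omega> f u \<longleftrightarrow>
    viscosity_subsolution \<alpha> \<Omega> f u \<and> viscosity_supersolution \<alpha> \<Omega> f u"

text \<open>On the compact sets \<^term>\<open>closure \<Omega>\<close> and \<^term>\<open>frontier \<Omega>\<close> the boundedness part of the
  \<open>C\<^sup>0\<^sup>,\<^sup>\<gamma>\<close> norm follows from the finite seminorm, so this is membership in that space.\<close>

definition holder_on :: "real \<Rightarrow> 'a::metric_space set \<Rightarrow> ('a \<Rightarrow> real) \<Rightarrow> bool"
  where "holder_on \<gamma> S u \<longleftrightarrow>
    (\<exists>C. \<forall>x\<in>S. \<forall>y\<in>S. \<bar>u x - u y\<bar> \<le> C * dist x y powr \<gamma>)"

definition locally_holder_on :: "real \<Rightarrow> 'a::metric_space set \<Rightarrow> ('a \<Rightarrow> real) \<Rightarrow> bool"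
  where "locally_holder_on \<gamma> \<Omega> u \<longleftrightarrow>
    (\<forall>\<omega>. compact (closure \<omega>) \<and> closure \<omega> \<subseteq> \<Omega> \<longrightarrow> holder_on \<gamma> \<omega> u)"

end

theory Submission
  imports Defs "HOL-Complex_Analysis.Great_Picard"
begin

text \<open>
  The solution is a limit of solutions on finite grids, and all of its regularity comes from comparing
  these grid solutions with cones.

  On a finite grid with points in \<^term>\<open>\<Omega>\<close> and in its frontier, the supremum and the infimum in the
  operator become a maximum and a minimum, and Perron's method is elementary
  (\<open>discrete_dirichlet_solvable\<close>). The bound \<open>K\<close> on the grid solutions depends only on
  \<^term>\<open>g\<close>, \<^term>\<open>f\<close> and the diameter, so on the interior points the operator applied
  to a grid solution is bounded by a constant \<open>C\<close>.

  For \<open>0 < \<beta> < \<alpha>\<close> the cone \<open>c + A * dist x x0 powr \<beta>\<close> is a strict supersolution away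
  from its vertex: the vertex gives the slope \<open>- A * r powr (\<beta> - \<alpha>)\<close> at distance \<open>r\<close>, and
  the elementary inequality \<open>powr_increment_le\<close> bounds all slopes by \<open>\<beta> / \<alpha>\<close> times its
  modulus. Large \<open>A\<close> pushes the operator of the cone below \<open>- C\<close>, and a maximum-point argument
  (\<open>discrete_comparison\<close>) shows that a grid solution below the cone on the boundary is below it
  everywhere. With vertices on the boundary and then anywhere, this carries a modulus
  \<open>\<epsilon> + A * dist x y powr \<beta>\<close> of the boundary values over to the whole grid, with constants
  independent of the grid (\<open>discrete_global_modulus\<close>). For \<open>\<epsilon> = 0\<close> this is the global
  Hoelder estimate, for small \<open>\<epsilon>\<close> it is equicontinuity for continuous \<^term>\<open>g\<close>. If the
  vertex is away from the frontier, the bound \<open>K\<close> already puts the cone above the boundary values,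
  which gives the local estimates. For \<^term>\<open>f\<close> nonnegative and \<open>\<alpha> < 1\<close> the same works with
  exponent \<open>\<alpha>\<close>: the operator of the cone is then strictly negative at every point by strict
  subadditivity, although without a uniform gap, and a strict sign at each point of a finite grid is enough
  (\<open>discrete_nonneg_below_critical_cone\<close>).

  Finer and finer grids then have convergent solutions along a subsequence, and the estimates survive the
  limit. That the limit solves the equation (\<open>discrete_limit_subsolution\<close>) rests on the upper
  semicontinuity of \<open>L\<^sup>+\<close> at a test function (\<open>eventually_slope_le_L_plus\<close>); the
  supersolution property follows by changing signs.
\<close>

section \<open>The operator on a finite grid\<close>

text \<open>
  The operator \<open>L\<^sup>+ + L\<^sup>-\<close> restricted to a finite grid \<^term>\<open>X\<close>. The value at the centre
  \<^term>\<open>x\<close> is a separate argument \<^term>\<open>t\<close>, so that the centre can be moved while its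
  neighbours stay fixed.
\<close>

definition discrete_L :: "real \<Rightarrow> 'a::metric_space set \<Rightarrow> ('a \<Rightarrow> real) \<Rightarrow> 'a \<Rightarrow> real \<Rightarrow> real"
  where "discrete_L \<alpha> X w x t =
    Max ((\<lambda>y. (w y - t) / dist y x powr \<alpha>) ` (X - {x})) +
    Min ((\<lambda>y. (w y - t) / dist y x powr \<alpha>) ` (X - {x}))"

text \<open>
  One statement for the three monotonicities used later: increasing in the neighbours, decreasing in
  the centre, and ordered at a point where the difference of two functions is maximal.
\<close>

lemma discrete_L_mono:
  assumes "finite X" and le: "\<And>y. y \<in> X \<Longrightarrow> y \<noteq> x \<Longrightarrow> w y - t \<le> w' y - t'"
  shows "discrete_L \<alpha> X w x t \<le> discrete_L \<alpha> X w' x t'"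
proof (cases "X - {x} = {}")
  case True
  then show ?thesis unfolding discrete_L_def True by simp
next
  case False
  let ?q = "\<lambda>w t y. (w y - t) / dist y x powr \<alpha>"
  have q: "?q w t y \<le> ?q w' t' y" if "y \<in> X - {x}" for y
    using le that by (intro divide_right_mono) auto
  have fin: "finite (X - {x})" using assms(1) by simp
  have "Max (?q w t ` (X - {x})) \<le> Max (?q w' t' ` (X - {x}))"
    using False fin q by (subst Max_le_iff) (auto intro: Max_ge_iff[THEN iffD2])
  moreover have "Min (?q w t ` (X - {x})) \<le> Min (?q w' t' ` (X - {x}))"
    using False fin q by (subst Min_ge_iff) (auto intro: Min_le_iff[THEN iffD2])
  ultimately show ?thesis unfolding discrete_L_def by linarith
qed

text \<open>
  The maximum is attained at \<^term>\<open>y\<close>, and any other grid point bounds the minimum.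
\<close>

lemma discrete_L_le_slopes:
  assumes "finite X" "X - {x} \<noteq> {}"
  obtains y where "y \<in> X" "y \<noteq> x"
    "\<And>z. z \<in> X \<Longrightarrow> z \<noteq> x \<Longrightarrow>
       discrete_L \<alpha> X w x t \<le> (w y - t) / dist y x powr \<alpha> + (w z - t) / dist z x powr \<alpha>"
proof -
  let ?S = "(\<lambda>y. (w y - t) / dist y x powr \<alpha>) ` (X - {x})"
  have S: "finite ?S" "?S \<noteq> {}" using assms by auto
  obtain y where "y \<in> X" "y \<noteq> x" and y: "Max ?S = (w y - t) / dist y x powr \<alpha>"
    using Max_in[OF S] by auto
  show ?thesis
  proof (rule that)
    fix z assume z: "z \<in> X" "z \<noteq> x"
    have "Min ?S \<le> (w z - t) / dist z x powr \<alpha>"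
      using z S by (intro Min_le) auto
    then show "discrete_L \<alpha> X w x t \<le> (w y - t) / dist y x powr \<alpha> + (w z - t) / dist z x powr \<alpha>"
      unfolding discrete_L_def y by simp
  qed fact+
qed

lemma discrete_L_uminus:
  assumes "finite X" "X - {x} \<noteq> {}"
  shows "discrete_L \<alpha> X (\<lambda>y. - w y) x (- t) = - discrete_L \<alpha> X w x t"
proof -
  let ?q = "\<lambda>y. (w y - t) / dist y x powr \<alpha>"
  let ?S = "?q ` (X - {x})"
  have S: "finite ?S" "?S \<noteq> {}" using assms by auto
  have "(- w y - - t) / dist y x powr \<alpha> = - ?q y" for y
    by (simp add: minus_divide_left)
  then have "(\<lambda>y. (- w y - - t) / dist y x powr \<alpha>) ` (X - {x}) = uminus ` ?S"
    unfolding image_image by simp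
  moreover have "Max (uminus ` ?S) = - Min ?S" "Min (uminus ` ?S) = - Max ?S"
    using minus_Max_eq_Min[OF S] minus_Min_eq_Max[OF S] by simp_all
  ultimately show ?thesis unfolding discrete_L_def by simp
qed

lemma continuous_on_Max_Min_image:
  fixes F :: "'b \<Rightarrow> 'c::topological_space \<Rightarrow> real"
  assumes "finite A" "A \<noteq> {}" "\<And>y. y \<in> A \<Longrightarrow> continuous_on S (F y)"
  shows "continuous_on S (\<lambda>t. Max ((\<lambda>y. F y t) ` A))"
    and "continuous_on S (\<lambda>t. Min ((\<lambda>y. F y t) ` A))"
  using assms
  by (induction A rule: finite_ne_induct) (auto intro!: continuous_on_max continuous_on_min)

text \<open>
  Perron's method perturbs one value at a time, so continuity in the value at the centre is the form
  in which continuity of the operator enters.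
\<close>

lemma continuous_on_discrete_L:
  assumes "finite X" "X - {x} \<noteq> {}"
  shows "continuous_on S (discrete_L \<alpha> X w x)"
  unfolding discrete_L_def using assms
  by (intro continuous_on_add continuous_on_Max_Min_image continuous_intros) auto

section \<open>The Dirichlet problem on a finite grid\<close>

text \<open>
  Perron's method. The pointwise supremum of the subsolutions lying between \<open>- K\<close> and
  \<open>K\<close>, where \<open>K = G + E * \<bar>f 0\<bar>\<close>, is again a subsolution, because raising neighbours
  raises the operator and the equation at \<^term>\<open>x\<close> is continuous in the value at \<^term>\<open>x\<close>. If
  the inequality were strict at \<^term>\<open>x\<close>, raising that single value a little would give a larger
  subsolution. The constant \<open>K\<close> is chosen such that a boundary point alone forces the slopes
  from \<open>\<plusminus> K\<close> to beat \<open>\<bar>f 0\<bar>\<close>; this makes \<open>- K\<close> a subsolution and keeps the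
  raised value below \<open>K\<close>.
\<close>

lemma discrete_dirichlet_solvable:
  fixes I B :: "'a::metric_space set"
  assumes fin: "finite I" "finite B" and disj: "I \<inter> B = {}" and "B \<noteq> {}"
    and f: "continuous_on UNIV f" "mono f"
    and G: "0 \<le> G" "\<And>b. b \<in> B \<Longrightarrow> \<bar>g b\<bar> \<le> G"
    and E: "0 \<le> E" "\<And>x y. x \<in> I \<union> B \<Longrightarrow> y \<in> I \<union> B \<Longrightarrow> dist x y powr \<alpha> \<le> E"
  obtains u where "\<And>b. b \<in> B \<Longrightarrow> u b = g b"
    and "\<And>x. x \<in> I \<union> B \<Longrightarrow> \<bar>u x\<bar> \<le> G + E * \<bar>f 0\<bar>"
    and "\<And>x. x \<in> I \<Longrightarrow> discrete_L \<alpha> (I \<union> B) u x (u x) = f (u x)"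
proof -
  define X where "X = I \<union> B"
  define K where "K = G + E * \<bar>f 0\<bar>"
  have K: "G \<le> K" "0 \<le> K" using G(1) E(1) by (auto simp: K_def)
  have finX: "finite X" using fin by (simp add: X_def)
  obtain b where b: "b \<in> B" using \<open>B \<noteq> {}\<close> by blast
  have bI: "b \<noteq> x" if "x \<in> I" for x using b that disj by auto
  have ne: "X - {x} \<noteq> {}" if "x \<in> I" for x using b bI[OF that] by (auto simp: X_def)
  \<comment> \<open>This inequality is what dictates \<open>K\<close>: the slope towards the boundary point \<open>b\<close> outweighs \<open>f 0\<close>.\<close>
  have slope_K: "\<bar>f 0\<bar> \<le> (K - c) / dist b x powr \<alpha>" if "x \<in> I" "c \<le> G" for x c
  proof -
    have "dist b x > 0" using bI[OF that(1)] by simp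
    have "\<bar>f 0\<bar> * dist b x powr \<alpha> \<le> \<bar>f 0\<bar> * E"
      using E(2)[of b x] b that by (intro mult_left_mono) auto
    also have "\<dots> \<le> K - c" using that by (simp add: K_def mult.commute)
    finally show ?thesis using \<open>dist b x > 0\<close> by (simp add: field_simps)
  qed
  have gb: "g b \<le> G" "- g b \<le> G" using G(2)[OF b] by auto
  have low: "f (-K) \<le> discrete_L \<alpha> X w x (-K)"
    if x: "x \<in> I" and w: "w b = g b" "\<And>y. y \<in> X \<Longrightarrow> -K \<le> w y" for x w
  proof -
    let ?S = "(\<lambda>y. (w y - -K) / dist y x powr \<alpha>) ` (X - {x})"
    have S: "finite ?S" "?S \<noteq> {}" using finX ne[OF x] by auto
    have "(w b - -K) / dist b x powr \<alpha> \<le> Max ?S"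
      using b bI[OF x] S by (intro Max_ge) (auto simp: X_def)
    moreover have "0 \<le> Min ?S"
      using S w(2) by (subst Min_ge_iff) (force simp: add_increasing)+
    ultimately have "(K + g b) / dist b x powr \<alpha> \<le> discrete_L \<alpha> X w x (-K)"
      unfolding discrete_L_def by (simp add: w algebra_simps)
    then show ?thesis
      using slope_K[OF x gb(2)] monoD[OF f(2), of "-K" 0] K by simp
  qed
  have high: "discrete_L \<alpha> X w x K \<le> f K"
    if x: "x \<in> I" and w: "w b = g b" "\<And>y. y \<in> X \<Longrightarrow> w y \<le> K" for x w
  proof -
    let ?S = "(\<lambda>y. (w y - K) / dist y x powr \<alpha>) ` (X - {x})"
    have S: "finite ?S" "?S \<noteq> {}" using finX ne[OF x] by auto
    have "Min ?S \<le> (w b - K) / dist b x powr \<alpha>"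
      using b bI[OF x] S by (intro Min_le) (auto simp: X_def)
    moreover have "Max ?S \<le> 0"
      using S w(2) by (subst Max_le_iff) (force simp: divide_nonpos_nonneg)+
    ultimately have "discrete_L \<alpha> X w x K \<le> - ((K - g b) / dist b x powr \<alpha>)"
      unfolding discrete_L_def by (simp add: w minus_divide_left)
    then show ?thesis
      using slope_K[OF x gb(1)] monoD[OF f(2), of 0 K] K by simp
  qed
  define S where "S = {w. (\<forall>c\<in>B. w c = g c) \<and> (\<forall>x\<in>X. \<bar>w x\<bar> \<le> K) \<and>
    (\<forall>x\<in>I. f (w x) \<le> discrete_L \<alpha> X w x (w x))}"
  define w0 where "w0 = (\<lambda>x. if x \<in> B then g x else - K)"
  have w0B: "\<bar>w0 c\<bar> \<le> K" for c using G(2) K by (fastforce simp: w0_def)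
  have "w0 \<in> S"
  proof -
    have "w0 x = -K" if "x \<in> I" for x using that disj by (auto simp: w0_def)
    moreover have "f (-K) \<le> discrete_L \<alpha> X w0 x (-K)" if "x \<in> I" for x
      using that b w0B by (intro low) (auto simp: w0_def abs_le_iff minus_le_iff)
    ultimately show ?thesis using w0B by (auto simp: S_def w0_def)
  qed
  define u where "u = (\<lambda>x. SUP w\<in>S. w x)"
  have bdd: "bdd_above ((\<lambda>w. w x) ` S)" if "x \<in> X" for x
    using that by (auto simp: S_def abs_le_iff intro!: bdd_aboveI[of _ K])
  have upper: "w x \<le> u x" if "w \<in> S" "x \<in> X" for w x
    unfolding u_def using that bdd by (intro cSUP_upper) auto
  have uB: "u c = g c" if "c \<in> B" for c
  proof -
    have "(\<lambda>w. w c) ` S = {g c}" using \<open>w0 \<in> S\<close> that by (auto simp: S_def)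
    then show ?thesis by (simp add: u_def)
  qed
  have uK: "\<bar>u x\<bar> \<le> K" if "x \<in> X" for x
  proof -
    have "u x \<le> K" unfolding u_def using \<open>w0 \<in> S\<close> that
      by (intro cSUP_least) (auto simp: S_def abs_le_iff)
    moreover have "- K \<le> u x" using upper[OF \<open>w0 \<in> S\<close> that] w0B[of x] by linarith
    ultimately show ?thesis by linarith
  qed
  define \<Phi> where "\<Phi> = (\<lambda>x t. discrete_L \<alpha> X u x t - f t)"
  have cont: "continuous_on UNIV (\<Phi> x)" if "x \<in> I" for x
    unfolding \<Phi>_def using ne[OF that] finX f(1)
    by (intro continuous_on_diff continuous_on_discrete_L) auto
  have sub: "0 \<le> \<Phi> x (u x)" if x: "x \<in> I" for x
  proof (rule ccontr)
    assume "\<not> 0 \<le> \<Phi> x (u x)"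
    moreover have "isCont (\<Phi> x) (u x)"
      using cont[OF x] by (simp add: continuous_on_eq_continuous_at)
    ultimately have "\<forall>\<^sub>F t in at (u x). \<Phi> x t < 0"
      by (intro order_tendstoD(2)[of _ "\<Phi> x (u x)"]) (auto simp: isCont_def)
    then obtain d where d: "d > 0" "\<And>t. t \<noteq> u x \<Longrightarrow> dist t (u x) < d \<Longrightarrow> \<Phi> x t < 0"
      unfolding eventually_at by auto
    \<comment> \<open>A member of the family nearly attaining the supremum at \<open>x\<close> would satisfy the reversed
      strict inequality there.\<close>
    have "\<exists>w\<in>S. u x - d < w x"
      unfolding u_def using \<open>w0 \<in> S\<close> d(1) x bdd[of x]
      by (subst less_cSUP_iff[symmetric]) (auto simp: X_def)
    then obtain w where w: "w \<in> S" "u x - d < w x" by blast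
    have "w x \<le> u x" using upper w(1) x by (simp add: X_def)
    then have "\<Phi> x (w x) < 0"
      using d w(2) \<open>\<not> 0 \<le> \<Phi> x (u x)\<close> by (cases "w x = u x") (auto simp: dist_real_def)
    moreover have "discrete_L \<alpha> X w x (w x) \<le> discrete_L \<alpha> X u x (w x)"
      using finX upper[OF w(1)] by (intro discrete_L_mono) auto
    ultimately show False using w(1) x by (force simp: S_def \<Phi>_def)
  qed
  have eq: "discrete_L \<alpha> X u x (u x) = f (u x)" if x: "x \<in> I" for x
  proof (rule ccontr)
    assume "\<not> ?thesis"
    then have pos: "\<Phi> x (u x) > 0" using sub[OF x] by (simp add: \<Phi>_def)
    have "u x \<noteq> K" using high[OF x, of u] pos uB[OF b] uK by (force simp: \<Phi>_def abs_le_iff)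
    then have "u x < K" using uK[of x] x by (auto simp: X_def)
    have "isCont (\<Phi> x) (u x)"
      using cont[OF x] by (simp add: continuous_on_eq_continuous_at)
    then have "\<forall>\<^sub>F t in at (u x). \<Phi> x t > 0"
      using pos by (intro order_tendstoD(1)[of _ "\<Phi> x (u x)"]) (auto simp: isCont_def)
    then obtain d where d: "d > 0" "\<And>t. t \<noteq> u x \<Longrightarrow> dist t (u x) < d \<Longrightarrow> \<Phi> x t > 0"
      unfolding eventually_at by auto
    define t where "t = min K (u x + d / 2)"
    have t: "u x < t" "t \<le> K" "dist t (u x) < d"
      using \<open>u x < K\<close> d(1) by (auto simp: t_def dist_real_def)
    define v where "v = u(x := t)"
    have uv: "u y \<le> v y" for y using t by (simp add: v_def)
    have "f (v y) \<le> discrete_L \<alpha> X v y (v y)" if y: "y \<in> I" for y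
    proof (cases "y = x")
      case True
      have "discrete_L \<alpha> X v x t = discrete_L \<alpha> X u x t"
        using finX by (intro antisym discrete_L_mono) (auto simp: v_def)
      then show ?thesis using d(2)[of t] t True by (simp add: v_def \<Phi>_def)
    next
      case False
      have "discrete_L \<alpha> X u y (u y) \<le> discrete_L \<alpha> X v y (u y)"
        using finX uv by (intro discrete_L_mono) auto
      then show ?thesis using sub[OF y] False by (simp add: v_def \<Phi>_def)
    qed
    moreover have "v c = g c" if "c \<in> B" for c
      using uB that x disj by (auto simp: v_def)
    moreover have "\<bar>v y\<bar> \<le> K" if "y \<in> X" for y
      using uK[OF that] uK[of x] x t by (auto simp: v_def X_def)
    ultimately have "v \<in> S" by (simp add: S_def)
    then have "v x \<le> u x" using upper x by (simp add: X_def)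
    then show False using t by (simp add: v_def)
  qed
  show ?thesis
    using that[of u] uB uK eq by (simp add: X_def K_def)
qed

text \<open>
  At a maximum of \<^term>\<open>\<lambda>x. u x - v x\<close> over the finite grid, \<open>discrete_L_mono\<close>
  contradicts the strict inequality.
\<close>

lemma discrete_comparison:
  assumes "finite X"
    and step: "\<And>x. x \<in> X \<Longrightarrow> u x \<le> v x \<or> discrete_L \<alpha> X v x (v x) < discrete_L \<alpha> X u x (u x)"
    and "x \<in> X"
  shows "u x \<le> v x"
proof (rule ccontr)
  assume "\<not> u x \<le> v x"
  let ?S = "(\<lambda>y. u y - v y) ` X"
  have S: "finite ?S" "?S \<noteq> {}" using assms by auto
  obtain z where z: "z \<in> X" "Max ?S = u z - v z" using Max_in[OF S] by auto
  have max: "u y - v y \<le> u z - v z" if "y \<in> X" for y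
    using Max_ge[OF S(1)] that z(2) by (metis image_eqI)
  have "discrete_L \<alpha> X u z (u z) \<le> discrete_L \<alpha> X v z (v z)"
    using \<open>finite X\<close> max by (intro discrete_L_mono) (auto simp: algebra_simps)
  then have "u z \<le> v z" using step[OF z(1)] by linarith
  with max[OF \<open>x \<in> X\<close>] \<open>\<not> u x \<le> v x\<close> show False by linarith
qed

section \<open>Cones as strict supersolutions\<close>

text \<open>
  With \<open>p = r / (r + t)\<close> and \<open>q = t / (r + t)\<close> this is \<open>1 = p + q < p powr \<alpha> + q powr \<alpha>\<close>.
\<close>

lemma powr_add_less:
  fixes r t :: real
  assumes "0 < r" "0 < t" "0 < \<alpha>" "\<alpha> < 1"
  shows "(r + t) powr \<alpha> < r powr \<alpha> + t powr \<alpha>"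
proof -
  have less: "p < p powr \<alpha>" if "0 < p" "p < 1" for p :: real
    using powr_less_mono'[of p \<alpha> 1] that assms by simp
  have "r / (r + t) + t / (r + t) < (r / (r + t)) powr \<alpha> + (t / (r + t)) powr \<alpha>"
    using assms by (intro add_strict_mono less) auto
  moreover have "r / (r + t) + t / (r + t) = 1" using assms by (simp flip: add_divide_distrib)
  ultimately have "1 < (r powr \<alpha> + t powr \<alpha>) / (r + t) powr \<alpha>"
    using assms by (simp add: powr_divide add_divide_distrib)
  then show ?thesis using assms by (simp add: field_simps)
qed

lemma powr_add_le:
  fixes r t :: real
  assumes "0 \<le> r" "0 \<le> t" "0 < \<alpha>" "\<alpha> \<le> 1"
  shows "(r + t) powr \<alpha> \<le> r powr \<alpha> + t powr \<alpha>"
proof (cases "r = 0 \<or> t = 0 \<or> \<alpha> = 1")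
  case True
  then show ?thesis using assms by auto
next
  case False
  then show ?thesis using powr_add_less[of r t \<alpha>] assms by simp
qed

text \<open>
  With \<open>\<theta> = \<beta> / \<alpha>\<close>, subadditivity gives
  \<open>(r + t) powr \<beta> \<le> (r powr \<alpha> + t powr \<alpha>) powr \<theta>\<close>, and the weighted
  arithmetic-geometric mean inequality (a Bernoulli inequality) linearizes the outer power. The factor
  \<open>\<beta> / \<alpha>\<close>, being below 1 for \<open>\<beta> < \<alpha>\<close>, is what makes cones strict
  supersolutions.
\<close>

lemma powr_increment_le:
  fixes r t :: real
  assumes "0 < r" "0 \<le> t" "0 < \<beta>" "\<beta> \<le> \<alpha>" "\<alpha> \<le> 1"
  shows "(r + t) powr \<beta> - r powr \<beta> \<le> \<beta> / \<alpha> * r powr (\<beta> - \<alpha>) * t powr \<alpha>"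
proof -
  define \<theta> where "\<theta> = \<beta> / \<alpha>"
  have \<theta>: "0 < \<theta>" "\<theta> \<le> 1" "\<alpha> * \<theta> = \<beta>" using assms by (auto simp: \<theta>_def)
  have "(r + t) powr \<beta> = ((r + t) powr \<alpha>) powr \<theta>" by (simp add: powr_powr \<theta>)
  also have "\<dots> \<le> (r powr \<alpha> + t powr \<alpha>) powr \<theta>"
    using assms \<theta> by (intro powr_mono2 powr_add_le) auto
  also have "\<dots> = (r powr \<alpha> + t powr \<alpha>) powr \<theta> * (r powr \<alpha>) powr (1 - \<theta>) * r powr (\<beta> - \<alpha>)"
    using assms \<theta> by (simp add: powr_powr algebra_simps flip: powr_add)
  also have "\<dots> \<le> (\<theta> * (r powr \<alpha> + t powr \<alpha>) + (1 - \<theta>) * r powr \<alpha>) * r powr (\<beta> - \<alpha>)"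
    using assms \<theta> by (intro mult_right_mono Youngs_inequality_0) (auto intro: add_pos_nonneg)
  also have "\<dots> = r powr (\<beta> - \<alpha>) * r powr \<alpha> + \<theta> * r powr (\<beta> - \<alpha>) * t powr \<alpha>"
    by (simp add: algebra_simps)
  also have "r powr (\<beta> - \<alpha>) * r powr \<alpha> = r powr \<beta>" by (simp flip: powr_add)
  finally show ?thesis by (simp add: \<theta>_def)
qed

text \<open>
  Seen from \<^term>\<open>x\<close>, the vertex \<^term>\<open>x0\<close> yields the slope
  \<open>- A * dist x x0 powr (\<beta> - \<alpha>)\<close>, whereas \<open>powr_increment_le\<close> bounds every
  slope by \<open>\<beta> / \<alpha>\<close> times its modulus.
\<close>

lemma discrete_L_cone_le:
  assumes "finite X" "x0 \<in> X" "x \<noteq> x0" "0 \<le> A" "0 < \<beta>" "\<beta> \<le> \<alpha>" "\<alpha> \<le> 1"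
  shows "discrete_L \<alpha> X (\<lambda>y. c + A * dist y x0 powr \<beta>) x (c + A * dist x x0 powr \<beta>)
    \<le> - (A * (1 - \<beta> / \<alpha>) * dist x x0 powr (\<beta> - \<alpha>))"
proof -
  define r where "r = dist x x0"
  have r: "r > 0" using assms(3) by (simp add: r_def)
  obtain y where y: "y \<in> X" "y \<noteq> x" and le: "\<And>z. z \<in> X \<Longrightarrow> z \<noteq> x \<Longrightarrow>
      discrete_L \<alpha> X (\<lambda>y. c + A * dist y x0 powr \<beta>) x (c + A * r powr \<beta>)
      \<le> (c + A * dist y x0 powr \<beta> - (c + A * r powr \<beta>)) / dist y x powr \<alpha>
        + (c + A * dist z x0 powr \<beta> - (c + A * r powr \<beta>)) / dist z x powr \<alpha>"
    using discrete_L_le_slopes[of X x \<alpha> "\<lambda>y. c + A * dist y x0 powr \<beta>" "c + A * r powr \<beta>"]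
      assms(1,2,3) by blast
  \<comment> \<open>The point \<open>y\<close> carries the maximal slope, the vertex \<open>x0\<close> bounds the minimal one.\<close>
  have "dist y x0 powr \<beta> - r powr \<beta> \<le> (r + dist y x) powr \<beta> - r powr \<beta>"
    using assms dist_triangle[of y x0 x] by (intro diff_right_mono powr_mono2) (auto simp: r_def)
  also have "\<dots> \<le> \<beta> / \<alpha> * r powr (\<beta> - \<alpha>) * dist y x powr \<alpha>"
    using r assms by (intro powr_increment_le) auto
  finally have "(dist y x0 powr \<beta> - r powr \<beta>) / dist y x powr \<alpha> \<le> \<beta> / \<alpha> * r powr (\<beta> - \<alpha>)"
    using y by (simp add: pos_divide_le_eq)
  from mult_left_mono[OF this \<open>0 \<le> A\<close>]
  have "(c + A * dist y x0 powr \<beta> - (c + A * r powr \<beta>)) / dist y x powr \<alpha>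
      \<le> A * (\<beta> / \<alpha> * r powr (\<beta> - \<alpha>))"
    by (simp add: algebra_simps diff_divide_distrib)
  moreover have "(c + A * dist x0 x0 powr \<beta> - (c + A * r powr \<beta>)) / dist x0 x powr \<alpha>
      = - (A * r powr (\<beta> - \<alpha>))"
    using assms by (simp add: powr_diff r_def dist_commute)
  ultimately show ?thesis
    using le[of x0] assms unfolding r_def[symmetric] by (simp add: algebra_simps)
qed

text \<open>
  At the critical exponent the two extreme slopes cancel in the limit of an unbounded domain. Strict
  subadditivity of \<open>t powr \<alpha>\<close> still gives a strict sign at each point of a finite grid. No
  uniform gap is available, hence this cone is only compared with functions for which the operator is
  nonnegative.
\<close>

lemma discrete_L_cone_less_0:
  assumes "finite X" "x0 \<in> X" "x \<noteq> x0" "0 < A" "0 < \<alpha>" "\<alpha> < 1"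
  shows "discrete_L \<alpha> X (\<lambda>y. c + A * dist y x0 powr \<alpha>) x (c + A * dist x x0 powr \<alpha>) < 0"
proof -
  define r where "r = dist x x0"
  have r: "r > 0" using assms(3) by (simp add: r_def)
  obtain y where y: "y \<in> X" "y \<noteq> x" and le: "\<And>z. z \<in> X \<Longrightarrow> z \<noteq> x \<Longrightarrow>
      discrete_L \<alpha> X (\<lambda>y. c + A * dist y x0 powr \<alpha>) x (c + A * r powr \<alpha>)
      \<le> (c + A * dist y x0 powr \<alpha> - (c + A * r powr \<alpha>)) / dist y x powr \<alpha>
        + (c + A * dist z x0 powr \<alpha> - (c + A * r powr \<alpha>)) / dist z x powr \<alpha>"
    using discrete_L_le_slopes[of X x \<alpha> "\<lambda>y. c + A * dist y x0 powr \<alpha>" "c + A * r powr \<alpha>"]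
      assms(1,2,3) by blast
  have "dist y x0 powr \<alpha> \<le> (r + dist y x) powr \<alpha>"
    using assms dist_triangle[of y x0 x] by (intro powr_mono2) (auto simp: r_def)
  also have "\<dots> < r powr \<alpha> + dist y x powr \<alpha>"
    using r y assms by (intro powr_add_less) auto
  finally have "(dist y x0 powr \<alpha> - r powr \<alpha>) / dist y x powr \<alpha> < 1"
    using y by (simp add: pos_divide_less_eq)
  from mult_strict_left_mono[OF this \<open>0 < A\<close>]
  have "(c + A * dist y x0 powr \<alpha> - (c + A * r powr \<alpha>)) / dist y x powr \<alpha> < A"
    by (simp add: algebra_simps diff_divide_distrib)
  moreover have "(c + A * dist x0 x0 powr \<alpha> - (c + A * r powr \<alpha>)) / dist x0 x powr \<alpha> = - A"
    using assms by (simp add: r_def dist_commute)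
  ultimately show ?thesis
    using le[of x0] assms unfolding r_def[symmetric] by simp
qed

section \<open>Grid-independent estimates\<close>

text \<open>
  The largest distance \<^term>\<open>D\<close> to the vertex is where the cone is least strict, so the
  condition on \<^term>\<open>A\<close> makes the operator of the cone smaller than \<open>- C\<close> everywhere. The
  constant does not depend on the grid.
\<close>

lemma discrete_subsolution_below_cone:
  assumes fin: "finite (I \<union> B)" and x0: "x0 \<in> I \<union> B" "u x0 \<le> c"
    and exps: "0 < \<beta>" "\<beta> < \<alpha>" "\<alpha> \<le> 1" and "0 \<le> A"
    and D: "\<And>x. x \<in> I \<union> B \<Longrightarrow> dist x x0 \<le> D" and A: "C < A * (1 - \<beta> / \<alpha>) * D powr (\<beta> - \<alpha>)"
    and sub: "\<And>x. x \<in> I \<Longrightarrow> - C \<le> discrete_L \<alpha> (I \<union> B) u x (u x)"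
    and bdry: "\<And>b. b \<in> B \<Longrightarrow> u b \<le> c + A * dist b x0 powr \<beta>"
    and x: "x \<in> I \<union> B"
  shows "u x \<le> c + A * dist x x0 powr \<beta>"
proof (rule discrete_comparison[OF fin _ x, of u _ \<alpha>])
  fix z assume z: "z \<in> I \<union> B"
  let ?v = "\<lambda>y. c + A * dist y x0 powr \<beta>"
  have "discrete_L \<alpha> (I \<union> B) ?v z (?v z) < discrete_L \<alpha> (I \<union> B) u z (u z)"
    if "z \<in> I" "z \<noteq> x0"
  proof -
    have "D powr (\<beta> - \<alpha>) \<le> dist z x0 powr (\<beta> - \<alpha>)"
      using D[OF z] exps that by (intro powr_mono2') auto
    then have "A * (1 - \<beta> / \<alpha>) * D powr (\<beta> - \<alpha>) \<le> A * (1 - \<beta> / \<alpha>) * dist z x0 powr (\<beta> - \<alpha>)"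
      using exps \<open>0 \<le> A\<close> by (intro mult_left_mono) auto
    moreover have "discrete_L \<alpha> (I \<union> B) ?v z (?v z)
        \<le> - (A * (1 - \<beta> / \<alpha>) * dist z x0 powr (\<beta> - \<alpha>))"
      using exps x0 that \<open>0 \<le> A\<close> fin by (intro discrete_L_cone_le) auto
    ultimately show ?thesis using sub[OF that(1)] A by linarith
  qed
  then show "u z \<le> ?v z \<or>
      discrete_L \<alpha> (I \<union> B) ?v z (?v z) < discrete_L \<alpha> (I \<union> B) u z (u z)"
    using z bdry x0(2) by (cases "z = x0") auto
qed

lemma discrete_nonneg_below_critical_cone:
  assumes fin: "finite (I \<union> B)" and x0: "x0 \<in> I \<union> B" "u x0 \<le> c"
    and exps: "0 < \<alpha>" "\<alpha> < 1" and "0 < A"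
    and sub: "\<And>x. x \<in> I \<Longrightarrow> 0 \<le> discrete_L \<alpha> (I \<union> B) u x (u x)"
    and bdry: "\<And>b. b \<in> B \<Longrightarrow> u b \<le> c + A * dist b x0 powr \<alpha>"
    and x: "x \<in> I \<union> B"
  shows "u x \<le> c + A * dist x x0 powr \<alpha>"
proof (rule discrete_comparison[OF fin _ x, of u _ \<alpha>])
  fix z assume z: "z \<in> I \<union> B"
  let ?v = "\<lambda>y. c + A * dist y x0 powr \<alpha>"
  have "discrete_L \<alpha> (I \<union> B) ?v z (?v z) < 0" if "z \<noteq> x0"
    using exps x0 that \<open>0 < A\<close> fin by (intro discrete_L_cone_less_0) auto
  then show "u z \<le> ?v z \<or>
      discrete_L \<alpha> (I \<union> B) ?v z (?v z) < discrete_L \<alpha> (I \<union> B) u z (u z)"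
    using z bdry x0(2) sub[of z] by (cases "z = x0") auto
qed

text \<open>
  The cone comparison is used twice: with vertex on the boundary, to transport the modulus of the boundary
  values to pairs of a boundary and an interior point, and then with an arbitrary vertex, where the first
  step supplies the inequality on the boundary. The additive \<^term>\<open>\<epsilon>\<close> lets the same
  argument serve boundary data that are merely continuous.
\<close>

lemma discrete_global_modulus:
  assumes fin: "finite (I \<union> B)" and disj: "I \<inter> B = {}" "B \<noteq> {}"
    and exps: "0 < \<beta>" "\<beta> < \<alpha>" "\<alpha> \<le> 1" and "0 \<le> A" "0 \<le> \<epsilon>"
    and D: "\<And>x y. x \<in> I \<union> B \<Longrightarrow> y \<in> I \<union> B \<Longrightarrow> dist x y \<le> D"
    and A: "C < A * (1 - \<beta> / \<alpha>) * D powr (\<beta> - \<alpha>)"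
    and eq: "\<And>x. x \<in> I \<Longrightarrow> \<bar>discrete_L \<alpha> (I \<union> B) u x (u x)\<bar> \<le> C"
    and bdry: "\<And>a b. a \<in> B \<Longrightarrow> b \<in> B \<Longrightarrow> \<bar>u a - u b\<bar> \<le> \<epsilon> + A * dist a b powr \<beta>"
    and x: "x \<in> I \<union> B" and y: "y \<in> I \<union> B"
  shows "\<bar>u x - u y\<bar> \<le> \<epsilon> + A * dist x y powr \<beta>"
proof -
  have sub: "- C \<le> discrete_L \<alpha> (I \<union> B) u x (u x)" if "x \<in> I" for x
    using eq[OF that] by linarith
  have sub': "- C \<le> discrete_L \<alpha> (I \<union> B) (\<lambda>y. - u y) x (- u x)" if "x \<in> I" for x
  proof -
    have "I \<union> B - {x} \<noteq> {}" using disj that by auto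
    with eq[OF that] fin show ?thesis by (subst discrete_L_uminus) auto
  qed
  have low: "u b \<le> u x + \<epsilon> + A * dist x b powr \<beta>" if "b \<in> B" "x \<in> I \<union> B" for b x
  proof -
    have "- u x \<le> - u b + \<epsilon> + A * dist x b powr \<beta>"
    proof (rule discrete_subsolution_below_cone[where u = "\<lambda>y. - u y" and I = I and B = B and \<alpha> = \<alpha>
          and C = C and D = D])
      show "- u a \<le> - u b + \<epsilon> + A * dist a b powr \<beta>" if "a \<in> B" for a
        using bdry[OF that \<open>b \<in> B\<close>] by linarith
    qed (use assms sub' that in auto)
    then show ?thesis by linarith
  qed
  have one_sided: "u x \<le> u y + \<epsilon> + A * dist x y powr \<beta>" if "x \<in> I \<union> B" "y \<in> I \<union> B" for x y
  proof (rule discrete_subsolution_below_cone[where u = u and I = I and B = B and \<alpha> = \<alpha>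
        and C = C and D = D])
    show "u b \<le> u y + \<epsilon> + A * dist b y powr \<beta>" if "b \<in> B" for b
      using low[OF that \<open>y \<in> I \<union> B\<close>] by (simp add: dist_commute)
  qed (use assms sub that in auto)
  show ?thesis using one_sided[OF x y] one_sided[OF y x] by (simp add: dist_commute abs_le_iff)
qed

section \<open>Nets and convergent subsequences\<close>

lemma bounded_finite_net:
  fixes S :: "'a::heine_borel set"
  assumes "bounded S" "0 < e"
  obtains F where "finite F" "F \<subseteq> S" "\<And>x. x \<in> closure S \<Longrightarrow> \<exists>y\<in>F. dist y x < e"
proof -
  have "compact (closure S)" using assms(1) by (simp add: compact_closure)
  moreover have "closure S \<subseteq> (\<Union>y\<in>S. ball y e)"
    using assms(2) by (auto simp: closure_approachable)
  ultimately obtain F where "F \<subseteq> S" "finite F" "closure S \<subseteq> (\<Union>y\<in>F. ball y e)"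
    using compactE_image[of "closure S" S "\<lambda>y. ball y e"] by (metis open_ball)
  then show ?thesis using that[of F] by fastforce
qed

text \<open>
  Asking for small oscillation only at large \<^term>\<open>k\<close> admits grid functions composed with a
  nearest-point map, which jump but whose jumps shrink with the grid. A diagonal sequence converges on a
  countable dense subset, and small oscillation extends the convergence to all of \<^term>\<open>S\<close>.
\<close>

lemma equicontinuous_convergent_subsequence:
  fixes S :: "'a::{metric_space, second_countable_topology} set" and v :: "nat \<Rightarrow> 'a \<Rightarrow> real"
  assumes bdd: "\<And>k x. x \<in> S \<Longrightarrow> \<bar>v k x\<bar> \<le> K"
    and eqc: "\<And>\<epsilon>. 0 < \<epsilon> \<Longrightarrow>
      \<exists>\<delta>>0. \<forall>x\<in>S. \<forall>y\<in>S. dist x y < \<delta> \<longrightarrow> (\<forall>\<^sub>F k in sequentially. \<bar>v k x - v k y\<bar> < \<epsilon>)"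
  obtains r :: "nat \<Rightarrow> nat" and u where "strict_mono r" "\<And>x. x \<in> S \<Longrightarrow> (\<lambda>k. v (r k) x) \<longlonglongrightarrow> u x"
proof -
  obtain T where T: "countable T" "T \<subseteq> S" "S \<subseteq> closure T"
    using separable[of S] by metis
  obtain r where r: "strict_mono r" "\<And>x. x \<in> T \<Longrightarrow> convergent (\<lambda>k. v (r k) x)"
    using function_convergent_subsequence[of T v K] T bdd unfolding convergent_def
    by (metis real_norm_def subsetD)
  have "convergent (\<lambda>k. v (r k) x)" if x: "x \<in> S" for x
  proof -
    have "Cauchy (\<lambda>k. v (r k) x)"
    proof (rule metric_CauchyI)
      fix e :: real assume "e > 0"
      then obtain \<delta> where \<delta>: "\<delta> > 0"
        "\<And>x y. x \<in> S \<Longrightarrow> y \<in> S \<Longrightarrow> dist x y < \<delta> \<Longrightarrow> (\<forall>\<^sub>F k in sequentially. \<bar>v k x - v k y\<bar> < e / 3)"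
        using eqc[of "e / 3"] by auto
      obtain y where y: "y \<in> T" "dist y x < \<delta>"
        using x T(3) \<delta>(1) by (meson closure_approachable subsetD)
      have "\<forall>\<^sub>F k in sequentially. \<bar>v k y - v k x\<bar> < e / 3"
        using \<delta>(2) y x T(2) by blast
      then have "\<forall>\<^sub>F k in sequentially. \<bar>v (r k) y - v (r k) x\<bar> < e / 3"
        by (rule eventually_subseq[OF r(1)])
      then obtain N1 where N1: "\<And>k. k \<ge> N1 \<Longrightarrow> \<bar>v (r k) y - v (r k) x\<bar> < e / 3"
        by (auto simp: eventually_sequentially)
      have "Cauchy (\<lambda>k. v (r k) y)" using r(2)[OF y(1)] by (rule convergent_Cauchy)
      then obtain N2 where N2: "\<And>k l. k \<ge> N2 \<Longrightarrow> l \<ge> N2 \<Longrightarrow> \<bar>v (r k) y - v (r l) y\<bar> < e / 3"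
        using metric_CauchyD[of "\<lambda>k. v (r k) y" "e / 3"] \<open>e > 0\<close> by (auto simp: dist_real_def)
      show "\<exists>N. \<forall>k\<ge>N. \<forall>l\<ge>N. dist (v (r k) x) (v (r l) x) < e"
      proof (intro exI[of _ "max N1 N2"] allI impI)
        fix k l assume "max N1 N2 \<le> k" "max N1 N2 \<le> l"
        then show "dist (v (r k) x) (v (r l) x) < e"
          using N1[of k] N1[of l] N2[of k l] unfolding dist_real_def by (simp, linarith)
      qed
    qed
    then show ?thesis by (simp add: Cauchy_convergent_iff)
  qed
  then have "(\<lambda>k. v (r k) x) \<longlonglongrightarrow> lim (\<lambda>k. v (r k) x)" if "x \<in> S" for x
    using that by (simp add: convergent_LIMSEQ_iff)
  then show ?thesis by (rule that[OF r(1)])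
qed

section \<open>Slopes of continuously differentiable functions\<close>

lemma C1_on_differentiable:
  assumes "C1_on \<Omega> \<phi>" "x \<in> \<Omega>"
  shows "\<phi> differentiable (at x)"
  using assms unfolding C1_on_def gderiv_def differentiable_def by blast

text \<open>
  Continuity of the gradient and the mean value inequality on a ball make the linear approximation at
  \<^term>\<open>x0\<close> uniform in both points. Slopes whose centre moves require this uniformity.
\<close>

lemma C1_on_strictly_differentiable:
  fixes \<Omega> :: "(real ^ 'n::finite) set"
  assumes "open \<Omega>" "C1_on \<Omega> \<phi>" "x0 \<in> \<Omega>"
  obtains p where "\<And>\<eta>. 0 < \<eta> \<Longrightarrow> \<exists>\<rho>>0. ball x0 \<rho> \<subseteq> \<Omega> \<and>
    (\<forall>x\<in>ball x0 \<rho>. \<forall>y\<in>ball x0 \<rho>. \<bar>\<phi> y - \<phi> x - inner p (y - x)\<bar> \<le> \<eta> * norm (y - x))"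
proof -
  obtain G where G: "\<And>x. x \<in> \<Omega> \<Longrightarrow> (\<phi> has_derivative (\<lambda>h. inner h (G x))) (at x)"
    and contG: "continuous_on \<Omega> G"
    using assms(2) by (auto simp: C1_on_def gderiv_def)
  have "\<exists>\<rho>>0. ball x0 \<rho> \<subseteq> \<Omega> \<and>
    (\<forall>x\<in>ball x0 \<rho>. \<forall>y\<in>ball x0 \<rho>. \<bar>\<phi> y - \<phi> x - inner (G x0) (y - x)\<bar> \<le> \<eta> * norm (y - x))"
    if "0 < \<eta>" for \<eta>
  proof -
    obtain \<rho>1 where \<rho>1: "\<rho>1 > 0" "ball x0 \<rho>1 \<subseteq> \<Omega>"
      using assms(1,3) by (meson open_contains_ball)
    obtain \<rho>2 where \<rho>2: "\<rho>2 > 0" "\<And>x. x \<in> \<Omega> \<Longrightarrow> dist x x0 < \<rho>2 \<Longrightarrow> dist (G x) (G x0) < \<eta>"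
      using contG[unfolded continuous_on_iff, rule_format, OF assms(3) \<open>0 < \<eta>\<close>] by blast
    define \<rho> where "\<rho> = min \<rho>1 \<rho>2"
    have sub: "ball x0 \<rho> \<subseteq> \<Omega>" using \<rho>1 by (auto simp: \<rho>_def)
    have "norm ((\<phi> y - inner (G x0) y) - (\<phi> x - inner (G x0) x)) \<le> \<eta> * norm (y - x)"
      if xy: "x \<in> ball x0 \<rho>" "y \<in> ball x0 \<rho>" for x y
    proof (rule differentiable_bound[where S = "ball x0 \<rho>" and f = "\<lambda>z. \<phi> z - inner (G x0) z"
          and f' = "\<lambda>z h. inner h (G z - G x0)", OF convex_ball _ _ xy(2,1)])
      fix z assume z: "z \<in> ball x0 \<rho>"
      show "((\<lambda>y. \<phi> y - inner (G x0) y) has_derivative (\<lambda>h. inner h (G z - G x0)))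
          (at z within ball x0 \<rho>)"
      proof -
        have "z \<in> \<Omega>" using z sub by blast
        have "((\<lambda>y. \<phi> y - inner (G x0) y) has_derivative (\<lambda>h. inner h (G z) - inner (G x0) h))
            (at z within ball x0 \<rho>)"
          by (rule has_derivative_diff[OF has_derivative_at_withinI[OF G[OF \<open>z \<in> \<Omega>\<close>]]])
            (auto intro!: derivative_eq_intros)
        then show ?thesis by (simp add: inner_diff_right inner_commute[of "G x0"])
      qed
      have "norm (G z - G x0) \<le> \<eta>"
        using \<rho>2(2)[of z] z sub by (auto simp: \<rho>_def dist_norm norm_minus_commute)
      show "onorm (\<lambda>h. inner h (G z - G x0)) \<le> \<eta>"
      proof (rule onorm_le)
        fix h :: "real ^ 'n"
        have "\<bar>inner h (G z - G x0)\<bar> \<le> norm h * norm (G z - G x0)"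
          by (rule Cauchy_Schwarz_ineq2)
        also have "\<dots> \<le> \<eta> * norm h"
          using mult_right_mono[OF \<open>norm (G z - G x0) \<le> \<eta>\<close>, of "norm h"] by (simp add: mult.commute)
        finally show "norm (inner h (G z - G x0)) \<le> \<eta> * norm h" by simp
      qed
    qed
    then have "\<bar>\<phi> y - \<phi> x - inner (G x0) (y - x)\<bar> \<le> \<eta> * norm (y - x)"
      if "x \<in> ball x0 \<rho>" "y \<in> ball x0 \<rho>" for x y
      using that by (force simp: inner_diff_right algebra_simps)
    moreover have "\<rho> > 0" using \<rho>1 \<rho>2 by (simp add: \<rho>_def)
    ultimately show ?thesis using sub by blast
  qed
  then show ?thesis using that by blast
qed

lemma slope_between_L_minus_L_plus:
  fixes \<Omega> :: "(real ^ 'n::finite) set"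
  assumes "bounded \<Omega>" "open \<Omega>" "0 < \<alpha>" "\<alpha> \<le> 1" "C1_on \<Omega> \<phi>" "continuous_on (closure \<Omega>) \<phi>" "x \<in> \<Omega>"
    and "y \<in> closure \<Omega>" "y \<noteq> x"
  shows "(\<phi> y - \<phi> x) / norm (y - x) powr \<alpha> \<le> L_plus \<alpha> \<Omega> \<phi> x"
    and "L_minus \<alpha> \<Omega> \<phi> x \<le> (\<phi> y - \<phi> x) / norm (y - x) powr \<alpha>"
proof -
  have b: "bounded (holder_quotients \<alpha> \<Omega> \<phi> x)"
    using assms by (intro holder_quotients_bounded C1_on_differentiable) auto
  have "(\<phi> y - \<phi> x) / norm (y - x) powr \<alpha> \<in> holder_quotients \<alpha> \<Omega> \<phi> x"
    using assms(8,9) unfolding holder_quotients_def by blast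
  then show "(\<phi> y - \<phi> x) / norm (y - x) powr \<alpha> \<le> L_plus \<alpha> \<Omega> \<phi> x"
    "L_minus \<alpha> \<Omega> \<phi> x \<le> (\<phi> y - \<phi> x) / norm (y - x) powr \<alpha>"
    unfolding L_plus_def L_minus_def
    using b by (auto intro: cSup_upper cInf_lower bounded_imp_bdd_above bounded_imp_bdd_below)
qed

text \<open>
  Upper semicontinuity of \<open>L\<^sup>+\<close>. Only slopes between points that both converge to
  \<^term>\<open>x0\<close> are delicate. Such a slope over a distance \<^term>\<open>t\<close> is, up to
  \<open>\<eta> * t powr (1 - \<alpha>)\<close>, at most the slope from \<^term>\<open>x0\<close> over the same distance in the
  direction of the gradient, and that one is bounded by \<open>L\<^sup>+\<close> at \<^term>\<open>x0\<close>. Since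
  only \<open>t \<le> t powr \<alpha>\<close> enters, the case \<open>\<alpha> = 1\<close> is included.
\<close>

lemma eventually_slope_le_L_plus:
  fixes \<Omega> :: "(real ^ 'n::finite) set"
  assumes \<Omega>: "bounded \<Omega>" "open \<Omega>" and \<alpha>: "0 < \<alpha>" "\<alpha> \<le> 1"
    and \<phi>: "C1_on \<Omega> \<phi>" "continuous_on (closure \<Omega>) \<phi>" and "x0 \<in> \<Omega>"
    and X: "X \<longlonglongrightarrow> x0" "\<And>k. X k \<in> closure \<Omega>"
    and Y: "Y \<longlonglongrightarrow> y0" "\<And>k. Y k \<in> closure \<Omega>" and "0 < \<eta>"
  shows "\<forall>\<^sub>F k in sequentially. Y k \<noteq> X k \<longrightarrow>
    (\<phi> (Y k) - \<phi> (X k)) / norm (Y k - X k) powr \<alpha> \<le> L_plus \<alpha> \<Omega> \<phi> x0 + \<eta>"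
proof (cases "y0 = x0")
  case False
  have y0: "y0 \<in> closure \<Omega>" using Y closed_sequentially[of "closure \<Omega>" Y y0] by simp
  have x0: "x0 \<in> closure \<Omega>" using \<open>x0 \<in> \<Omega>\<close> closure_subset by blast
  have "(\<lambda>k. (\<phi> (Y k) - \<phi> (X k)) / norm (Y k - X k) powr \<alpha>)
      \<longlonglongrightarrow> (\<phi> y0 - \<phi> x0) / norm (y0 - x0) powr \<alpha>"
    using False X Y x0 y0 by (intro tendsto_intros continuous_on_tendsto_compose[OF \<phi>(2)]) auto
  moreover have "(\<phi> y0 - \<phi> x0) / norm (y0 - x0) powr \<alpha> < L_plus \<alpha> \<Omega> \<phi> x0 + \<eta>"
    using slope_between_L_minus_L_plus(1)[OF \<Omega> \<alpha> \<phi> \<open>x0 \<in> \<Omega>\<close> y0 False] \<open>0 < \<eta>\<close> by linarith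
  ultimately have "\<forall>\<^sub>F k in sequentially.
      (\<phi> (Y k) - \<phi> (X k)) / norm (Y k - X k) powr \<alpha> < L_plus \<alpha> \<Omega> \<phi> x0 + \<eta>"
    by (rule order_tendstoD)
  then show ?thesis by eventually_elim simp
next
  case True
  obtain p where p: "\<And>\<eta>. 0 < \<eta> \<Longrightarrow> \<exists>\<rho>>0. ball x0 \<rho> \<subseteq> \<Omega> \<and>
    (\<forall>x\<in>ball x0 \<rho>. \<forall>y\<in>ball x0 \<rho>. \<bar>\<phi> y - \<phi> x - inner p (y - x)\<bar> \<le> \<eta> * norm (y - x))"
    using C1_on_strictly_differentiable[OF \<Omega>(2) \<phi>(1) \<open>x0 \<in> \<Omega>\<close>] by blast
  obtain \<rho> where \<rho>: "\<rho> > 0" "ball x0 \<rho> \<subseteq> \<Omega>" and strict: "\<And>x y. x \<in> ball x0 \<rho> \<Longrightarrow> y \<in> ball x0 \<rho> \<Longrightarrow>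
      \<bar>\<phi> y - \<phi> x - inner p (y - x)\<bar> \<le> \<eta> / 2 * norm (y - x)"
    using p[of "\<eta> / 2"] \<open>0 < \<eta>\<close> by auto
  obtain e :: "real ^ 'n" where e: "norm e = 1" "inner p e = norm p"
  proof (cases "p = 0")
    case True
    obtain e :: "real ^ 'n" where "norm e = 1" using vector_choose_size[of 1] by auto
    then show ?thesis using that True by simp
  next
    case False
    then show ?thesis using that[of "p /\<^sub>R norm p"]
      by (simp add: power2_norm_eq_inner[symmetric] power2_eq_square field_simps)
  qed
  have "(\<lambda>k. norm (Y k - X k)) \<longlonglongrightarrow> norm (x0 - x0)"
    using X Y True by (intro tendsto_intros) auto
  then have "\<forall>\<^sub>F k in sequentially. norm (Y k - X k) < min \<rho> 1"
    using \<rho>(1) by (intro order_tendstoD(2)[of _ "norm (x0 - x0)"]) auto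
  moreover have "\<forall>\<^sub>F k in sequentially. dist (X k) x0 < \<rho>" "\<forall>\<^sub>F k in sequentially. dist (Y k) x0 < \<rho>"
    using X Y True \<rho>(1) by (auto intro: tendstoD)
  ultimately show ?thesis
  proof eventually_elim
    case (elim k)
    show ?case
    proof
      assume "Y k \<noteq> X k"
      \<comment> \<open>Comparison with the point \<open>z\<close> at the same distance from \<open>x0\<close> in the gradient direction.\<close>
      define t where "t = norm (Y k - X k)"
      have t: "0 < t" "t < \<rho>" "t < 1" using elim \<open>Y k \<noteq> X k\<close> by (auto simp: t_def)
      define z where "z = x0 + t *\<^sub>R e"
      have z: "norm (z - x0) = t" "z \<in> ball x0 \<rho>" "inner p (z - x0) = t * norm p"
        using t e by (auto simp: z_def dist_norm)
      have "\<bar>\<phi> (Y k) - \<phi> (X k) - inner p (Y k - X k)\<bar> \<le> \<eta> / 2 * t"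
        unfolding t_def using elim by (intro strict) (auto simp: dist_commute)
      then have "\<phi> (Y k) - \<phi> (X k) \<le> inner p (Y k - X k) + \<eta> / 2 * t" by linarith
      also have "\<dots> \<le> norm p * t + \<eta> / 2 * t"
        using norm_cauchy_schwarz[of p "Y k - X k"] by (simp add: t_def)
      also have "norm p * t \<le> \<phi> z - \<phi> x0 + \<eta> / 2 * t"
      proof -
        have "\<bar>\<phi> z - \<phi> x0 - t * norm p\<bar> \<le> \<eta> / 2 * t"
          unfolding z(1)[symmetric] z(3)[unfolded z(1)[symmetric], symmetric]
          using z(2) \<rho>(1) by (intro strict) auto
        then have "t * norm p \<le> \<phi> z - \<phi> x0 + \<eta> / 2 * t" by linarith
        then show ?thesis by (simp only: mult.commute[of "norm p"])
      qed
      finally have "\<phi> (Y k) - \<phi> (X k) \<le> \<phi> z - \<phi> x0 + \<eta> * t" by simp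
      then have "(\<phi> (Y k) - \<phi> (X k)) / t powr \<alpha> \<le> (\<phi> z - \<phi> x0 + \<eta> * t) / t powr \<alpha>"
        by (intro divide_right_mono) auto
      also have "\<dots> = (\<phi> z - \<phi> x0) / norm (z - x0) powr \<alpha> + \<eta> * (t / t powr \<alpha>)"
        by (simp add: z add_divide_distrib)
      also have "(\<phi> z - \<phi> x0) / norm (z - x0) powr \<alpha> \<le> L_plus \<alpha> \<Omega> \<phi> x0"
        using \<rho>(2) z t closure_subset[of \<Omega>] by (intro slope_between_L_minus_L_plus \<Omega> \<alpha> \<phi> \<open>x0 \<in> \<Omega>\<close>) auto
      also have "\<eta> * (t / t powr \<alpha>) \<le> \<eta> * 1"
        using powr_mono'[of \<alpha> 1 t] t \<alpha> \<open>0 < \<eta>\<close> by (intro mult_left_mono) auto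
      finally show "(\<phi> (Y k) - \<phi> (X k)) / norm (Y k - X k) powr \<alpha> \<le> L_plus \<alpha> \<Omega> \<phi> x0 + \<eta>"
        by (simp add: t_def)
    qed
  qed
qed

lemma L_op_le_add:
  fixes \<Omega> :: "(real ^ 'n::finite) set"
  assumes \<Omega>: "bounded \<Omega>" "open \<Omega>" and \<alpha>: "0 < \<alpha>" "\<alpha> \<le> 1" and "x \<in> \<Omega>"
    and \<phi>: "C1_on \<Omega> \<phi>" "continuous_on (closure \<Omega>) \<phi>"
    and \<psi>: "C1_on \<Omega> \<psi>" "continuous_on (closure \<Omega>) \<psi>"
    and le: "\<And>y. y \<in> closure \<Omega> \<Longrightarrow> y \<noteq> x \<Longrightarrow>
      (\<psi> y - \<psi> x) / norm (y - x) powr \<alpha> \<le> (\<phi> y - \<phi> x) / norm (y - x) powr \<alpha> + c"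
  shows "L_op \<alpha> \<Omega> \<psi> x \<le> L_op \<alpha> \<Omega> \<phi> x + 2 * c"
proof -
  have ne: "holder_quotients \<alpha> \<Omega> w x \<noteq> {}" for w
    using holder_quotients_bounded(1)[OF \<Omega> \<open>x \<in> \<Omega>\<close> \<alpha> \<phi>(2) C1_on_differentiable[OF \<phi>(1) \<open>x \<in> \<Omega>\<close>]]
    unfolding holder_quotients_def by auto
  have "L_plus \<alpha> \<Omega> \<psi> x \<le> L_plus \<alpha> \<Omega> \<phi> x + c"
    unfolding L_plus_def[of _ _ \<psi>]
  proof (rule cSup_least[OF ne])
    fix q assume "q \<in> holder_quotients \<alpha> \<Omega> \<psi> x"
    then obtain y where "y \<in> closure \<Omega>" "y \<noteq> x" "q = (\<psi> y - \<psi> x) / norm (y - x) powr \<alpha>"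
      by (auto simp: holder_quotients_def)
    then show "q \<le> L_plus \<alpha> \<Omega> \<phi> x + c"
      using le[of y] slope_between_L_minus_L_plus(1)[OF \<Omega> \<alpha> \<phi> \<open>x \<in> \<Omega>\<close>, of y] by linarith
  qed
  moreover have "L_minus \<alpha> \<Omega> \<psi> x - c \<le> L_minus \<alpha> \<Omega> \<phi> x"
    unfolding L_minus_def[of _ _ \<phi>]
  proof (rule cInf_greatest[OF ne])
    fix q assume "q \<in> holder_quotients \<alpha> \<Omega> \<phi> x"
    then obtain y where "y \<in> closure \<Omega>" "y \<noteq> x" "q = (\<phi> y - \<phi> x) / norm (y - x) powr \<alpha>"
      by (auto simp: holder_quotients_def)
    then show "L_minus \<alpha> \<Omega> \<psi> x - c \<le> q"
      using le[of y] slope_between_L_minus_L_plus(2)[OF \<Omega> \<alpha> \<psi> \<open>x \<in> \<Omega>\<close>, of y] by linarith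
  qed
  ultimately show ?thesis unfolding L_op_def by linarith
qed

lemma L_op_uminus: "L_op \<alpha> \<Omega> (\<lambda>x. - w x) x = - L_op \<alpha> \<Omega> w x"
proof -
  have "(- w y - - w x) / norm (y - x) powr \<alpha> = - ((w y - w x) / norm (y - x) powr \<alpha>)" for y
    by (simp add: minus_divide_left)
  then have "holder_quotients \<alpha> \<Omega> (\<lambda>x. - w x) x = uminus ` holder_quotients \<alpha> \<Omega> w x"
    by (auto simp: holder_quotients_def image_iff)
  then show ?thesis
    by (simp add: L_op_def L_plus_def L_minus_def Inf_real_def image_image)
qed

section \<open>Viscosity inequalities in the limit\<close>

lemma C1_on_uminus: "C1_on \<Omega> \<phi> \<Longrightarrow> C1_on \<Omega> (\<lambda>x. - \<phi> x)"
  unfolding C1_on_def using GDERIV_minus continuous_on_minus by metis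

lemma viscosity_supersolution_uminus:
  assumes "viscosity_subsolution \<alpha> \<Omega> (\<lambda>t. - f (- t)) (\<lambda>x. - u x)"
  shows "viscosity_supersolution \<alpha> \<Omega> f u"
  unfolding viscosity_supersolution_def
proof (intro conjI allI impI)
  show "lsc_on (closure \<Omega>) u"
    unfolding lsc_on_def
  proof (intro ballI allI impI)
    fix x c assume "x \<in> closure \<Omega>" "c < u x"
    moreover have "- c > - u x" using \<open>c < u x\<close> by simp
    ultimately have "\<forall>\<^sub>F y in at x within closure \<Omega>. - u y < - c"
      using assms unfolding viscosity_subsolution_def usc_on_def by blast
    then show "\<forall>\<^sub>F y in at x within closure \<Omega>. c < u y" by simp
  qed
next
  fix \<phi> x0
  assume "C1_on \<Omega> \<phi> \<and> continuous_on (closure \<Omega>) \<phi> \<and>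
    (\<forall>x\<in>closure \<Omega>. \<phi> x \<le> u x) \<and> x0 \<in> \<Omega> \<and> u x0 = \<phi> x0"
  then have "C1_on \<Omega> (\<lambda>x. - \<phi> x) \<and> continuous_on (closure \<Omega>) (\<lambda>x. - \<phi> x) \<and>
      (\<forall>x\<in>closure \<Omega>. - u x \<le> - \<phi> x) \<and> x0 \<in> \<Omega> \<and> - u x0 = - \<phi> x0"
    by (simp add: C1_on_uminus continuous_on_minus)
  then have "- L_op \<alpha> \<Omega> (\<lambda>x. - \<phi> x) x0 + - f (- (- \<phi> x0)) \<le> 0"
    using assms unfolding viscosity_subsolution_def by blast
  then show "0 \<le> - L_op \<alpha> \<Omega> \<phi> x0 + f (\<phi> x0)" by (simp add: L_op_uminus)
qed

lemma continuous_on_imp_usc_on: "continuous_on S u \<Longrightarrow> usc_on S u"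
  unfolding usc_on_def continuous_on_def by (auto intro: order_tendstoD)

lemma C1_on_add_square:
  assumes "C1_on \<Omega> \<phi>"
  shows "C1_on \<Omega> (\<lambda>x. \<phi> x + \<delta> * (norm (x - x0))\<^sup>2)"
proof -
  obtain G where G: "\<And>x. x \<in> \<Omega> \<Longrightarrow> (\<phi> has_derivative (\<lambda>h. inner h (G x))) (at x)" "continuous_on \<Omega> G"
    using assms by (auto simp: C1_on_def gderiv_def)
  have "((\<lambda>x. \<phi> x + \<delta> * (norm (x - x0))\<^sup>2) has_derivative
      (\<lambda>h. inner h (G x + (2 * \<delta>) *\<^sub>R (x - x0)))) (at x)" if "x \<in> \<Omega>" for x
  proof -
    have "((\<lambda>x. \<phi> x + \<delta> * inner (x - x0) (x - x0)) has_derivative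
        (\<lambda>h. inner h (G x) + \<delta> * (inner (x - x0) h + inner h (x - x0)))) (at x)"
      by (rule has_derivative_add[OF G(1)[OF that]]) (auto intro!: derivative_eq_intros)
    then show ?thesis
      unfolding power2_norm_eq_inner
      by (simp add: inner_add_right inner_commute[of "x - x0"] mult_ac)
  qed
  moreover have "continuous_on \<Omega> (\<lambda>x. G x + (2 * \<delta>) *\<^sub>R (x - x0))"
    by (intro continuous_intros G)
  ultimately show ?thesis
    unfolding C1_on_def gderiv_def by (intro exI[of _ "\<lambda>x. G x + (2 * \<delta>) *\<^sub>R (x - x0)"]) auto
qed

text \<open>
  Stability. A test function touching \<^term>\<open>u\<close> from above at \<^term>\<open>x0\<close> is made strict by
  adding \<open>\<delta> * (norm (x - x0))\<^sup>2\<close>; then the maximum points over the grids converge to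
  \<^term>\<open>x0\<close>, and there \<open>discrete_L_mono\<close> passes the grid inequality on to the test function. The
  maximal slope is controlled in the limit by semicontinuity of \<open>L\<^sup>+\<close>. The minimal slope is at
  most the slope towards a grid point close to any fixed \<^term>\<open>z\<close> different from
  \<^term>\<open>x0\<close>, and this slope converges; the infimum over \<^term>\<open>z\<close> gives \<open>L\<^sup>-\<close>.
\<close>

lemma discrete_limit_subsolution:
  fixes \<Omega> :: "(real ^ 'n::finite) set" and I B :: "nat \<Rightarrow> (real ^ 'n) set"
  assumes \<Omega>: "bounded \<Omega>" "open \<Omega>" and \<alpha>: "0 < \<alpha>" "\<alpha> \<le> 1" and f: "continuous_on UNIV f"
    and fin: "\<And>k. finite (I k)" "\<And>k. finite (B k)"
    and grid: "\<And>k. I k \<subseteq> \<Omega>" "\<And>k. B k \<subseteq> frontier \<Omega>" "\<And>k. B k \<noteq> {}"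
    and proj: "\<And>k x. x \<in> closure \<Omega> \<Longrightarrow> p k x \<in> I k \<union> B k"
      "\<And>x. x \<in> closure \<Omega> \<Longrightarrow> (\<lambda>k. p k x) \<longlonglongrightarrow> x"
    and lim: "\<And>x. x \<in> closure \<Omega> \<Longrightarrow> (\<lambda>k. v k (p k x)) \<longlonglongrightarrow> u x"
    and eqc: "\<And>\<epsilon>. 0 < \<epsilon> \<Longrightarrow> \<exists>\<delta>>0. \<forall>k. \<forall>x\<in>I k \<union> B k. \<forall>y\<in>I k \<union> B k.
      dist x y < \<delta> \<longrightarrow> \<bar>v k x - v k y\<bar> < \<epsilon>"
    and sub: "\<And>k x. x \<in> I k \<Longrightarrow> f (v k x) \<le> discrete_L \<alpha> (I k \<union> B k) (v k) x (v k x)"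
    and u: "continuous_on (closure \<Omega>) u"
  shows "viscosity_subsolution \<alpha> \<Omega> f u"
proof -
  define X where "X = (\<lambda>k. I k \<union> B k)"
  have XI: "x \<in> I k" if "x \<in> X k" "x \<in> \<Omega>" for x k
    using that grid(2) \<Omega>(2) by (auto simp: X_def frontier_def interior_open)
  have Xcl: "x \<in> closure \<Omega>" if "x \<in> X k" for x k
    using that grid(1,2)[of k] closure_subset[of \<Omega>] by (auto simp: X_def frontier_def)
  have finX: "finite (X k)" for k using fin by (simp add: X_def)
  have neX: "X k \<noteq> {}" for k using grid(3)[of k] by (auto simp: X_def)
  have pX: "p k x \<in> X k" if "x \<in> closure \<Omega>" for k x using proj(1)[OF that] by (simp add: X_def)
  have eqcX: "\<exists>\<delta>>0. \<forall>k. \<forall>x\<in>X k. \<forall>y\<in>X k. dist x y < \<delta> \<longrightarrow> \<bar>v k x - v k y\<bar> < \<epsilon>"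
    if "0 < \<epsilon>" for \<epsilon>
    unfolding X_def using that by (rule eqc)
  \<comment> \<open>Equicontinuity upgrades convergence along \<open>p\<close> to convergence along all grid points tending
    to the same limit.\<close>
  have conv: "(\<lambda>k. v (s k) (z k)) \<longlonglongrightarrow> u z0"
    if s: "strict_mono s" and z: "\<And>k. z k \<in> X (s k)" "z \<longlonglongrightarrow> z0" "z0 \<in> closure \<Omega>" for s z z0
  proof -
    have "(\<lambda>k. v (s k) (z k) - v (s k) (p (s k) z0)) \<longlonglongrightarrow> 0"
    proof (rule tendstoI)
      fix \<epsilon> :: real assume "0 < \<epsilon>"
      from eqcX[OF this] obtain \<delta> where \<delta>: "\<delta> > 0"
        "\<forall>k. \<forall>x\<in>X k. \<forall>y\<in>X k. dist x y < \<delta> \<longrightarrow> \<bar>v k x - v k y\<bar> < \<epsilon>"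
        by (elim exE conjE)
      have "(\<lambda>k. p (s k) z0) \<longlonglongrightarrow> z0"
        using LIMSEQ_subseq_LIMSEQ[OF proj(2)[OF z(3)] s] by (simp add: o_def)
      with z(2) have "(\<lambda>k. dist (z k) (p (s k) z0)) \<longlonglongrightarrow> dist z0 z0" by (intro tendsto_dist)
      then have "\<forall>\<^sub>F k in sequentially. dist (z k) (p (s k) z0) < \<delta>"
        using \<delta>(1) by (intro order_tendstoD(2)) auto
      then show "\<forall>\<^sub>F k in sequentially. dist (v (s k) (z k) - v (s k) (p (s k) z0)) 0 < \<epsilon>"
      proof eventually_elim
        case (elim k)
        then show ?case using \<delta>(2) z(1)[of k] pX[OF z(3), of "s k"] by (simp add: dist_real_def)
      qed
    qed
    moreover have "(\<lambda>k. v (s k) (p (s k) z0)) \<longlonglongrightarrow> u z0"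
      using LIMSEQ_subseq_LIMSEQ[OF lim[OF z(3)] s] by (simp add: o_def)
    ultimately have "(\<lambda>k. (v (s k) (z k) - v (s k) (p (s k) z0)) + v (s k) (p (s k) z0)) \<longlonglongrightarrow> 0 + u z0"
      by (rule tendsto_add)
    then show ?thesis by simp
  qed
  have *: "f (\<phi> x0) \<le> L_op \<alpha> \<Omega> \<phi> x0"
    if \<phi>: "C1_on \<Omega> \<phi>" "continuous_on (closure \<Omega>) \<phi>"
      and touch: "\<And>x. x \<in> closure \<Omega> \<Longrightarrow> u x \<le> \<phi> x" "x0 \<in> \<Omega>" "u x0 = \<phi> x0" for \<phi> x0
  proof -
    have x0: "x0 \<in> closure \<Omega>" using touch(2) closure_subset by blast
    have strict: "f (\<phi> x0) \<le> L_op \<alpha> \<Omega> (\<lambda>x. \<phi> x + \<delta> * (norm (x - x0))\<^sup>2) x0" if "0 < \<delta>" for \<delta>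
    proof -
      define \<psi> where "\<psi> = (\<lambda>x. \<phi> x + \<delta> * (norm (x - x0))\<^sup>2)"
      have \<psi>: "C1_on \<Omega> \<psi>" "continuous_on (closure \<Omega>) \<psi>"
        unfolding \<psi>_def using C1_on_add_square[OF \<phi>(1)] \<phi>(2) by (auto intro!: continuous_intros)
      have "\<exists>x. x \<in> X k \<and> (\<forall>z\<in>X k. v k z - \<psi> z \<le> v k x - \<psi> x)" for k
      proof -
        let ?S = "(\<lambda>x. v k x - \<psi> x) ` X k"
        have S: "finite ?S" "?S \<noteq> {}" using finX neX by auto
        obtain x where "x \<in> X k" "Max ?S = v k x - \<psi> x" using Max_in[OF S] by auto
        moreover have "v k z - \<psi> z \<le> Max ?S" if "z \<in> X k" for z using that S by (intro Max_ge) auto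
        ultimately show ?thesis by auto
      qed
      then obtain x where xX: "\<And>k. x k \<in> X k" and xmax: "\<And>k z. z \<in> X k \<Longrightarrow> v k z - \<psi> z \<le> v k (x k) - \<psi> (x k)"
        by metis
      have "\<exists>y. y \<in> X k \<and> (X k - {x k} \<noteq> {} \<longrightarrow> y \<noteq> x k \<and> (\<forall>z\<in>X k. z \<noteq> x k \<longrightarrow>
          discrete_L \<alpha> (X k) \<psi> (x k) (\<psi> (x k)) \<le> (\<psi> y - \<psi> (x k)) / norm (y - x k) powr \<alpha>
            + (\<psi> z - \<psi> (x k)) / norm (z - x k) powr \<alpha>))" for k
      proof (cases "X k - {x k} = {}")
        case True
        then show ?thesis using xX by blast
      next
        case False
        obtain y where "y \<in> X k" "y \<noteq> x k" "\<And>z. z \<in> X k \<Longrightarrow> z \<noteq> x k \<Longrightarrow>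
          discrete_L \<alpha> (X k) \<psi> (x k) (\<psi> (x k)) \<le> (\<psi> y - \<psi> (x k)) / norm (y - x k) powr \<alpha>
            + (\<psi> z - \<psi> (x k)) / norm (z - x k) powr \<alpha>"
          using discrete_L_le_slopes[OF finX False, of \<alpha> \<psi> "\<psi> (x k)"] unfolding dist_norm by blast
        then show ?thesis by (intro exI[of _ y]) simp
      qed
      from choice[OF allI[OF this]] obtain y where yk: "\<forall>k. y k \<in> X k \<and> (X k - {x k} \<noteq> {} \<longrightarrow>
          y k \<noteq> x k \<and> (\<forall>z\<in>X k. z \<noteq> x k \<longrightarrow>
          discrete_L \<alpha> (X k) \<psi> (x k) (\<psi> (x k)) \<le> (\<psi> (y k) - \<psi> (x k)) / norm (y k - x k) powr \<alpha>
            + (\<psi> z - \<psi> (x k)) / norm (z - x k) powr \<alpha>))" ..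
      have yX: "y k \<in> X k" for k using yk by blast
      have y: "y k \<noteq> x k \<and>
          discrete_L \<alpha> (X k) \<psi> (x k) (\<psi> (x k)) \<le> (\<psi> (y k) - \<psi> (x k)) / norm (y k - x k) powr \<alpha>
            + (\<psi> z - \<psi> (x k)) / norm (z - x k) powr \<alpha>" if "z \<in> X k" "z \<noteq> x k" for k z
      proof -
        have "X k - {x k} \<noteq> {}" using that by blast
        then show ?thesis using yk that by blast
      qed
      have "compact (closure \<Omega> \<times> closure \<Omega>)"
        using \<Omega>(1) by (intro compact_Times) (auto simp: compact_closure)
      then have "seq_compact (closure \<Omega> \<times> closure \<Omega>)" by (rule compact_imp_seq_compact)
      moreover have "\<forall>k. (x k, y k) \<in> closure \<Omega> \<times> closure \<Omega>" using Xcl[OF xX] Xcl[OF yX] by simp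
      ultimately obtain l s where l: "l \<in> closure \<Omega> \<times> closure \<Omega>" and s: "strict_mono s"
        and ls: "((\<lambda>k. (x k, y k)) \<circ> s) \<longlonglongrightarrow> l"
        by (rule seq_compactE)
      obtain x' y' where l': "l = (x', y')" by (cases l)
      have cl': "x' \<in> closure \<Omega>" "y' \<in> closure \<Omega>" using l l' by auto
      have xs: "(\<lambda>k. x (s k)) \<longlonglongrightarrow> x'" and ys: "(\<lambda>k. y (s k)) \<longlonglongrightarrow> y'"
        using tendsto_fst[OF ls] tendsto_snd[OF ls] by (simp_all add: l' o_def)
      have vx: "(\<lambda>k. v (s k) (x (s k))) \<longlonglongrightarrow> u x'"
        using conv[OF s _ xs] xX cl' by blast
      have ps: "(\<lambda>k. p (s k) z) \<longlonglongrightarrow> z" if "z \<in> closure \<Omega>" for z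
        using LIMSEQ_subseq_LIMSEQ[OF proj(2)[OF that] s] by (simp add: o_def)
      have vp: "(\<lambda>k. v (s k) (p (s k) x0)) \<longlonglongrightarrow> u x0"
        using LIMSEQ_subseq_LIMSEQ[OF lim[OF x0] s] by (simp add: o_def)
      have \<psi>t: "(\<lambda>k. \<psi> (z k)) \<longlonglongrightarrow> \<psi> z0" if "\<And>k. z k \<in> X (s k)" "z \<longlonglongrightarrow> z0" "z0 \<in> closure \<Omega>" for z z0
        by (rule continuous_on_tendsto_compose[OF \<psi>(2) that(2,3)]) (simp add: Xcl[OF that(1)])
      have "u x0 - \<psi> x0 \<le> u x' - \<psi> x'"
      proof (rule LIMSEQ_le)
        show "(\<lambda>k. v (s k) (p (s k) x0) - \<psi> (p (s k) x0)) \<longlonglongrightarrow> u x0 - \<psi> x0"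
          by (intro tendsto_diff vp \<psi>t pX ps x0)
        show "(\<lambda>k. v (s k) (x (s k)) - \<psi> (x (s k))) \<longlonglongrightarrow> u x' - \<psi> x'"
          by (intro tendsto_diff vx \<psi>t xX xs cl')
        show "\<exists>N. \<forall>n\<ge>N. v (s n) (p (s n) x0) - \<psi> (p (s n) x0) \<le> v (s n) (x (s n)) - \<psi> (x (s n))"
          using xmax pX x0 by blast
      qed
      then have "\<delta> * (norm (x' - x0))\<^sup>2 \<le> 0"
        using touch(1)[OF cl'(1)] touch(3) by (simp add: \<psi>_def)
      then have "x' = x0" using \<open>0 < \<delta>\<close> by (simp add: mult_le_0_iff)
      have evI: "\<forall>\<^sub>F k in sequentially. x (s k) \<in> I (s k)"
        using topological_tendstoD[OF xs[unfolded \<open>x' = x0\<close>] \<Omega>(2) touch(2)]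
        by eventually_elim (rule XI[OF xX])
      have slope: "f (\<phi> x0) - L_plus \<alpha> \<Omega> \<psi> x0 \<le> (\<psi> z - \<psi> x0) / norm (z - x0) powr \<alpha>"
        if z: "z \<in> closure \<Omega>" "z \<noteq> x0" for z
      proof (rule field_le_epsilon)
        fix \<eta> :: real assume "0 < \<eta>"
        define q where "q = (\<lambda>k. (\<psi> (p (s k) z) - \<psi> (x (s k))) / norm (p (s k) z - x (s k)) powr \<alpha>)"
        have q: "q \<longlonglongrightarrow> (\<psi> z - \<psi> x0) / norm (z - x0) powr \<alpha>"
          unfolding q_def using z(2)
          by (intro tendsto_intros ps[OF z(1)] xs[unfolded \<open>x' = x0\<close>]
              \<psi>t[OF pX[OF z(1)] ps[OF z(1)] z(1)] \<psi>t[OF xX xs[unfolded \<open>x' = x0\<close>] x0]) auto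
        have fv: "(\<lambda>k. f (v (s k) (x (s k)))) \<longlonglongrightarrow> f (u x0)"
          using vx \<open>x' = x0\<close> f by (intro continuous_on_tendsto_compose[OF f]) auto
        have "(\<lambda>k. p (s k) z - x (s k)) \<longlonglongrightarrow> z - x0"
          using ps[OF z(1)] xs \<open>x' = x0\<close> by (intro tendsto_diff) auto
        then have "\<forall>\<^sub>F k in sequentially. p (s k) z - x (s k) \<noteq> 0"
          using z(2) by (intro tendsto_imp_eventually_ne) auto
        moreover have "\<forall>\<^sub>F k in sequentially. y (s k) \<noteq> x (s k) \<longrightarrow>
            (\<psi> (y (s k)) - \<psi> (x (s k))) / norm (y (s k) - x (s k)) powr \<alpha> \<le> L_plus \<alpha> \<Omega> \<psi> x0 + \<eta>"
          using xs ys \<open>x' = x0\<close> xX yX Xcl \<open>0 < \<eta>\<close> touch(2)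
          by (intro eventually_slope_le_L_plus \<Omega> \<alpha> \<psi>) auto
        ultimately have "\<forall>\<^sub>F k in sequentially. f (v (s k) (x (s k))) \<le> L_plus \<alpha> \<Omega> \<psi> x0 + \<eta> + q k"
          using evI
        proof eventually_elim
          case (elim k)
          let ?k = "s k" and ?x = "x (s k)"
          have pz: "p ?k z \<in> X ?k" "p ?k z \<noteq> ?x" using pX z(1) elim by auto
          have "f (v ?k ?x) \<le> discrete_L \<alpha> (X ?k) (v ?k) ?x (v ?k ?x)"
            using sub elim by (simp add: X_def)
          also have "\<dots> \<le> discrete_L \<alpha> (X ?k) \<psi> ?x (\<psi> ?x)"
          proof (rule discrete_L_mono[OF finX])
            fix z assume "z \<in> X ?k"
            then show "v ?k z - v ?k ?x \<le> \<psi> z - \<psi> ?x" using xmax[of z ?k] by linarith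
          qed
          also have "\<dots> \<le> (\<psi> (y ?k) - \<psi> ?x) / norm (y ?k - ?x) powr \<alpha> + q k"
            using y[OF pz] by (simp add: q_def)
          finally show ?case using y[OF pz] elim by linarith
        qed
        then have "f (u x0) \<le> L_plus \<alpha> \<Omega> \<psi> x0 + \<eta> + (\<psi> z - \<psi> x0) / norm (z - x0) powr \<alpha>"
          by (intro tendsto_le[OF sequentially_bot tendsto_add[OF tendsto_const q] fv])
        then show "f (\<phi> x0) - L_plus \<alpha> \<Omega> \<psi> x0 \<le> (\<psi> z - \<psi> x0) / norm (z - x0) powr \<alpha> + \<eta>"
          using touch(3) by simp
      qed
      have "f (\<phi> x0) - L_plus \<alpha> \<Omega> \<psi> x0 \<le> L_minus \<alpha> \<Omega> \<psi> x0"
        unfolding L_minus_def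
      proof (rule cInf_greatest)
        show "holder_quotients \<alpha> \<Omega> \<psi> x0 \<noteq> {}"
          using \<Omega> \<alpha> \<psi> touch(2) by (intro holder_quotients_bounded C1_on_differentiable) auto
      qed (use slope in \<open>auto simp: holder_quotients_def\<close>)
      then show ?thesis unfolding L_op_def \<psi>_def by linarith
    qed
    obtain D where D: "0 < D" "\<And>y. y \<in> closure \<Omega> \<Longrightarrow> norm (y - x0) \<le> D"
    proof -
      obtain R where "R > 0" "\<And>y. y \<in> closure \<Omega> \<Longrightarrow> norm y \<le> R"
        using bounded_closure[OF \<Omega>(1)] unfolding bounded_pos by blast
      then show ?thesis
        using that[of "R + norm x0"] norm_triangle_ineq4[of _ x0]
        by (meson add_mono add_pos_nonneg norm_ge_zero order_refl order_trans)
    qed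
    have pert: "f (\<phi> x0) \<le> L_op \<alpha> \<Omega> \<phi> x0 + 2 * (\<delta> * D powr (2 - \<alpha>))" if "0 < \<delta>" for \<delta>
    proof -
      let ?\<psi> = "\<lambda>x. \<phi> x + \<delta> * (norm (x - x0))\<^sup>2"
      have "L_op \<alpha> \<Omega> ?\<psi> x0 \<le> L_op \<alpha> \<Omega> \<phi> x0 + 2 * (\<delta> * D powr (2 - \<alpha>))"
      proof (rule L_op_le_add[OF \<Omega> \<alpha> touch(2) \<phi>])
        show "C1_on \<Omega> ?\<psi>" "continuous_on (closure \<Omega>) ?\<psi>"
          using C1_on_add_square[OF \<phi>(1)] \<phi>(2) by (auto intro!: continuous_intros)
      next
        fix y assume y: "y \<in> closure \<Omega>" "y \<noteq> x0"
        have "(norm (y - x0))\<^sup>2 / norm (y - x0) powr \<alpha> = norm (y - x0) powr (2 - \<alpha>)"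
          using y by (simp add: powr_diff)
        also have "\<dots> \<le> D powr (2 - \<alpha>)" using D(2)[OF y(1)] \<alpha> by (intro powr_mono2) auto
        finally have "\<delta> * ((norm (y - x0))\<^sup>2 / norm (y - x0) powr \<alpha>) \<le> \<delta> * D powr (2 - \<alpha>)"
          using \<open>0 < \<delta>\<close> by (intro mult_left_mono) auto
        then show "(?\<psi> y - ?\<psi> x0) / norm (y - x0) powr \<alpha>
            \<le> (\<phi> y - \<phi> x0) / norm (y - x0) powr \<alpha> + \<delta> * D powr (2 - \<alpha>)"
          by (simp add: add_divide_distrib diff_divide_distrib)
      qed
      with strict[OF that] show ?thesis by linarith
    qed
    show ?thesis
    proof (rule field_le_epsilon)
      fix \<eta> :: real assume "0 < \<eta>"
      then show "f (\<phi> x0) \<le> L_op \<alpha> \<Omega> \<phi> x0 + \<eta>"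
        using pert[of "\<eta> / (2 * D powr (2 - \<alpha>))"] D(1) by simp
    qed
  qed
  show ?thesis
    unfolding viscosity_subsolution_def
  proof (intro conjI allI impI)
    fix \<phi> x0
    assume "C1_on \<Omega> \<phi> \<and> continuous_on (closure \<Omega>) \<phi> \<and>
      (\<forall>x\<in>closure \<Omega>. u x \<le> \<phi> x) \<and> x0 \<in> \<Omega> \<and> u x0 = \<phi> x0"
    then have "f (\<phi> x0) \<le> L_op \<alpha> \<Omega> \<phi> x0" by (intro *) auto
    then show "- L_op \<alpha> \<Omega> \<phi> x0 + f (\<phi> x0) \<le> 0" by simp
  qed (rule continuous_on_imp_usc_on[OF u])
qed

section \<open>Existence and regularity\<close>

text \<open>
  Two nets are needed, one in the open set and one in its frontier, since only grid points of the
  frontier carry boundary values. The map \<^term>\<open>p\<close> chooses nearby grid points and sends the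
  frontier into itself, which makes the boundary condition pass to the limit.
\<close>

lemma bounded_open_grids:
  fixes \<Omega> :: "'a::euclidean_space set"
  assumes \<Omega>: "bounded \<Omega>" "open \<Omega>" "\<Omega> \<noteq> {}"
  obtains I B :: "nat \<Rightarrow> 'a set" and p :: "nat \<Rightarrow> 'a \<Rightarrow> 'a"
  where "\<And>k. finite (I k)" "\<And>k. finite (B k)" "\<And>k. I k \<subseteq> \<Omega>" "\<And>k. B k \<subseteq> frontier \<Omega>" "\<And>k. B k \<noteq> {}"
    and "\<And>k x. x \<in> closure \<Omega> \<Longrightarrow> p k x \<in> I k \<union> B k"
    and "\<And>k x. x \<in> frontier \<Omega> \<Longrightarrow> p k x \<in> B k"
    and "\<And>x. x \<in> closure \<Omega> \<Longrightarrow> (\<lambda>k. p k x) \<longlonglongrightarrow> x"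
proof -
  define e where "e = (\<lambda>k. inverse (real (Suc k)))"
  have e: "0 < e k" for k by (simp add: e_def)
  have *: "\<exists>F. finite F \<and> F \<subseteq> S \<and> (\<forall>x\<in>closure S. \<exists>y\<in>F. dist y x < e k)" if "bounded S" for S :: "'a set" and k
    using bounded_finite_net[OF that e[of k]] by metis
  define N where "N = (\<lambda>(S :: 'a set) k. SOME F. finite F \<and> F \<subseteq> S \<and> (\<forall>x\<in>closure S. \<exists>y\<in>F. dist y x < e k))"
  have N: "finite (N S k) \<and> N S k \<subseteq> S \<and> (\<forall>x\<in>closure S. \<exists>y\<in>N S k. dist y x < e k)"
    if "bounded S" for S k
    unfolding N_def by (rule someI_ex[OF *[OF that]])
  have fb: "bounded (frontier \<Omega>)" by (rule compact_imp_bounded[OF compact_frontier_bounded[OF \<Omega>(1)]])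
  have "frontier \<Omega> \<noteq> {}"
    using \<Omega> frontier_eq_empty not_bounded_UNIV by metis
  then obtain b where b: "b \<in> frontier \<Omega>" by blast
  let ?I = "N \<Omega>" and ?B = "N (frontier \<Omega>)"
  have "\<exists>y. y \<in> ?I k \<union> ?B k \<and> dist y x < e k \<and> (x \<in> frontier \<Omega> \<longrightarrow> y \<in> ?B k)"
    if "x \<in> closure \<Omega>" for k x
  proof (cases "x \<in> frontier \<Omega>")
    case True
    then show ?thesis using N[OF fb, of k] closure_subset[of "frontier \<Omega>"] by blast
  next
    case False
    then show ?thesis using N[OF \<Omega>(1), of k] that by blast
  qed
  then have "\<forall>k x. \<exists>y. x \<in> closure \<Omega> \<longrightarrow>
      y \<in> ?I k \<union> ?B k \<and> dist y x < e k \<and> (x \<in> frontier \<Omega> \<longrightarrow> y \<in> ?B k)" by blast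
  then obtain p where "\<forall>k x. x \<in> closure \<Omega> \<longrightarrow>
      p k x \<in> ?I k \<union> ?B k \<and> dist (p k x) x < e k \<and> (x \<in> frontier \<Omega> \<longrightarrow> p k x \<in> ?B k)"
    by metis
  then have p: "p k x \<in> ?I k \<union> ?B k \<and> dist (p k x) x < e k \<and> (x \<in> frontier \<Omega> \<longrightarrow> p k x \<in> ?B k)"
    if "x \<in> closure \<Omega>" for k x using that by blast
  have lim: "(\<lambda>k. p k x) \<longlonglongrightarrow> x" if "x \<in> closure \<Omega>" for x
  proof (rule metric_tendsto_imp_tendsto)
    show "e \<longlonglongrightarrow> 0" unfolding e_def by (rule LIMSEQ_inverse_real_of_nat)
    show "\<forall>\<^sub>F k in sequentially. dist (p k x) x \<le> dist (e k) 0"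
      using p[OF that] e by (intro always_eventually) (simp add: less_imp_le)
  qed
  have cl: "x \<in> closure \<Omega>" if "x \<in> frontier \<Omega>" for x using that by (simp add: frontier_def)
  have "?B k \<noteq> {}" for k using p[OF cl[OF b], of k] b by blast
  then show ?thesis
    using N[OF \<Omega>(1)] N[OF fb] p cl lim by (intro that[of ?I ?B p]) blast+
qed

lemma compact_continuous_holder_modulus:
  fixes g :: "'a::metric_space \<Rightarrow> real"
  assumes "compact S" "continuous_on S g" "0 < \<epsilon>" "0 < \<beta>"
  obtains A where "0 \<le> A" "\<And>a b. a \<in> S \<Longrightarrow> b \<in> S \<Longrightarrow> \<bar>g a - g b\<bar> \<le> \<epsilon> + A * dist a b powr \<beta>"
proof -
  have "uniformly_continuous_on S g" using assms by (intro compact_uniformly_continuous)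
  then obtain \<delta> where \<delta>: "\<delta> > 0" "\<And>a b. a \<in> S \<Longrightarrow> b \<in> S \<Longrightarrow> dist a b < \<delta> \<Longrightarrow> \<bar>g a - g b\<bar> < \<epsilon>"
    unfolding uniformly_continuous_on_def dist_real_def using \<open>0 < \<epsilon>\<close> by metis
  have "bounded (g ` S)" using assms compact_continuous_image compact_imp_bounded by blast
  then obtain G where G: "0 < G" "\<And>a. a \<in> S \<Longrightarrow> \<bar>g a\<bar> \<le> G" by (auto simp: bounded_pos)
  show ?thesis
  proof (rule that[of "2 * G / \<delta> powr \<beta>"])
    fix a b assume ab: "a \<in> S" "b \<in> S"
    show "\<bar>g a - g b\<bar> \<le> \<epsilon> + 2 * G / \<delta> powr \<beta> * dist a b powr \<beta>"
    proof (cases "dist a b < \<delta>")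
      case True
      have "0 \<le> 2 * G / \<delta> powr \<beta> * dist a b powr \<beta>" using G(1) by simp
      then show ?thesis using \<delta>(2)[OF ab True] by linarith
    next
      case False
      have "\<bar>g a - g b\<bar> \<le> 2 * G" using G(2)[OF ab(1)] G(2)[OF ab(2)] by linarith
      also have "\<dots> = 2 * G / \<delta> powr \<beta> * \<delta> powr \<beta>" using \<delta>(1) by simp
      also have "\<dots> \<le> 2 * G / \<delta> powr \<beta> * dist a b powr \<beta>"
        using False \<delta>(1) G(1) assms(4) by (intro mult_left_mono powr_mono2) auto
      finally show ?thesis using assms(3) by linarith
    qed
  qed (use G(1) in auto)
qed

lemma holder_modulus_imp_small:
  fixes A \<epsilon> \<beta> :: real
  assumes "0 \<le> A" "0 < \<epsilon>" "0 < \<beta>"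
  obtains \<delta> where "0 < \<delta>" "\<And>t. 0 \<le> t \<Longrightarrow> t < \<delta> \<Longrightarrow> A * t powr \<beta> < \<epsilon>"
proof -
  define \<delta> where "\<delta> = (\<epsilon> / (A + 1)) powr (1 / \<beta>)"
  have "0 < \<delta>" using assms by (simp add: \<delta>_def)
  moreover have "A * t powr \<beta> < \<epsilon>" if "0 \<le> t" "t < \<delta>" for t
  proof -
    have "t powr \<beta> < \<delta> powr \<beta>" using that assms(3) by (intro powr_less_mono2) auto
    also have "\<dots> = \<epsilon> / (A + 1)" using assms by (simp add: \<delta>_def powr_powr)
    finally have "(A + 1) * t powr \<beta> < \<epsilon>" using assms(1) by (simp add: field_simps)
    moreover have "A * t powr \<beta> \<le> (A + 1) * t powr \<beta>" by (intro mult_right_mono) auto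
    ultimately show ?thesis by linarith
  qed
  ultimately show ?thesis using that by blast
qed

lemma holder_modulus_limit:
  fixes X Y :: "nat \<Rightarrow> 'a::metric_space" and a b :: "nat \<Rightarrow> real"
  assumes "X \<longlonglongrightarrow> x" "Y \<longlonglongrightarrow> y" "a \<longlonglongrightarrow> s" "b \<longlonglongrightarrow> t" "0 < \<beta>"
    and le: "\<forall>\<^sub>F k in sequentially. \<bar>a k - b k\<bar> \<le> \<epsilon> + A * dist (X k) (Y k) powr \<beta>"
  shows "\<bar>s - t\<bar> \<le> \<epsilon> + A * dist x y powr \<beta>"
proof (rule tendsto_le[OF sequentially_bot _ _ le])
  show "(\<lambda>k. \<epsilon> + A * dist (X k) (Y k) powr \<beta>) \<longlonglongrightarrow> \<epsilon> + A * dist x y powr \<beta>"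
    using assms by (intro tendsto_add tendsto_mult tendsto_const tendsto_powr' tendsto_dist) auto
  show "(\<lambda>k. \<bar>a k - b k\<bar>) \<longlonglongrightarrow> \<bar>s - t\<bar>"
    using assms by (intro tendsto_rabs tendsto_diff)
qed

text \<open>
  The grid solutions share the bound \<open>K\<close> and, by comparison with cones, every modulus of the
  form \<open>\<epsilon> + A * dist x y powr \<beta>\<close> that the boundary data have, once \<open>A \<ge> A0 \<beta>\<close>. A
  subsequence therefore converges, and each estimate with constants independent of the grid holds for the
  limit. A cone with vertex at distance \<open>d\<close> from the frontier and \<open>A * d powr \<gamma> \<ge> 2 * K\<close> exceeds the
  boundary values because of the bound \<open>K\<close> alone, and this yields the local estimates.
\<close>

lemma viscosity_solution_exists:
  fixes \<Omega> :: "(real ^ 'n::finite) set" and g :: "real ^ 'n \<Rightarrow> real"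
  assumes \<Omega>: "bounded \<Omega>" "open \<Omega>" "\<Omega> \<noteq> {}"
    and \<alpha>: "0 < \<alpha>" "\<alpha> \<le> 1"
    and f: "continuous_on UNIV f" "mono f"
    and g: "continuous_on (frontier \<Omega>) g"
  obtains u where "viscosity_solution \<alpha> \<Omega> f u" "\<And>x. x \<in> frontier \<Omega> \<Longrightarrow> u x = g x"
    and "\<And>\<beta>. 0 < \<beta> \<Longrightarrow> \<beta> < \<alpha> \<Longrightarrow> locally_holder_on \<beta> \<Omega> u"
    and "\<And>\<beta>. 0 < \<beta> \<Longrightarrow> \<beta> < \<alpha> \<Longrightarrow> holder_on \<beta> (frontier \<Omega>) g \<Longrightarrow> holder_on \<beta> (closure \<Omega>) u"
    and "\<alpha> < 1 \<Longrightarrow> (\<And>t. 0 \<le> f t) \<Longrightarrow> locally_holder_on \<alpha> \<Omega> u"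
proof -
  have frcl: "x \<in> closure \<Omega>" if "x \<in> frontier \<Omega>" for x using that by (simp add: frontier_def)
  have cfr: "compact (frontier \<Omega>)" using \<Omega>(1) by (rule compact_frontier_bounded)
  \<comment> \<open>The summand 1 keeps \<open>D\<close> positive.\<close>
  define D where "D = diameter (closure \<Omega>) + 1"
  have D: "0 < D" "\<And>x y. x \<in> closure \<Omega> \<Longrightarrow> y \<in> closure \<Omega> \<Longrightarrow> dist x y \<le> D"
    using diameter_bounded_bound[OF bounded_closure[OF \<Omega>(1)]] diameter_ge_0[OF bounded_closure[OF \<Omega>(1)]]
    by (auto simp: D_def add_increasing2)
  have "bounded (g ` frontier \<Omega>)" using cfr g compact_continuous_image compact_imp_bounded by blast
  then obtain G where G: "0 < G" "\<And>a. a \<in> frontier \<Omega> \<Longrightarrow> \<bar>g a\<bar> \<le> G" by (auto simp: bounded_pos)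
  define K where "K = G + D powr \<alpha> * \<bar>f 0\<bar>"
  have K: "0 < K" using G(1) by (auto simp: K_def intro: add_pos_nonneg)
  define C where "C = max \<bar>f (- K)\<bar> \<bar>f K\<bar>"
  have C: "0 \<le> C" "\<And>t. \<bar>t\<bar> \<le> K \<Longrightarrow> \<bar>f t\<bar> \<le> C"
    using monoD[OF f(2)] by (auto simp: C_def abs_le_iff) (smt (verit) monoD[OF f(2)])+
  obtain I B p where fin: "\<And>k. finite (I k)" "\<And>k. finite (B k)"
    and IB: "\<And>k. I k \<subseteq> \<Omega>" "\<And>k. B k \<subseteq> frontier \<Omega>" "\<And>k. B k \<noteq> {}"
    and p: "\<And>k x. x \<in> closure \<Omega> \<Longrightarrow> p k x \<in> I k \<union> B k"
      "\<And>k x. x \<in> frontier \<Omega> \<Longrightarrow> p k x \<in> B k"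
      "\<And>x. x \<in> closure \<Omega> \<Longrightarrow> (\<lambda>k. p k x) \<longlonglongrightarrow> x"
    using bounded_open_grids[OF \<Omega>] by blast
  have disj: "I k \<inter> B k = {}" for k
    using IB(1,2)[of k] \<Omega>(2) by (auto simp: frontier_def interior_open)
  have Xcl: "x \<in> closure \<Omega>" if "x \<in> I k \<union> B k" for x k
    using that IB(1,2)[of k] closure_subset[of \<Omega>] frcl by blast
  have finX: "finite (I k \<union> B k)" for k using fin by simp
  have "\<exists>w. (\<forall>b\<in>B k. w b = g b) \<and> (\<forall>x\<in>I k \<union> B k. \<bar>w x\<bar> \<le> K) \<and>
      (\<forall>x\<in>I k. discrete_L \<alpha> (I k \<union> B k) w x (w x) = f (w x))" for k
  proof -
    obtain w where "\<And>b. b \<in> B k \<Longrightarrow> w b = g b" "\<And>x. x \<in> I k \<union> B k \<Longrightarrow> \<bar>w x\<bar> \<le> K"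
      "\<And>x. x \<in> I k \<Longrightarrow> discrete_L \<alpha> (I k \<union> B k) w x (w x) = f (w x)"
    proof (rule discrete_dirichlet_solvable[OF fin(1,2)[of k] disj[of k] IB(3)[of k] f, of G g "D powr \<alpha>" \<alpha>])
      show "dist x y powr \<alpha> \<le> D powr \<alpha>" if "x \<in> I k \<union> B k" "y \<in> I k \<union> B k" for x y
        using D(2) Xcl that \<alpha> by (intro powr_mono2) auto
    qed (use G IB(2)[of k] in \<open>auto simp: K_def\<close>)
    then show ?thesis by blast
  qed
  then obtain w where w: "\<And>k b. b \<in> B k \<Longrightarrow> w k b = g b" "\<And>k x. x \<in> I k \<union> B k \<Longrightarrow> \<bar>w k x\<bar> \<le> K"
    "\<And>k x. x \<in> I k \<Longrightarrow> discrete_L \<alpha> (I k \<union> B k) (w k) x (w k x) = f (w k x)"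
    by metis
  have fw: "\<bar>discrete_L \<alpha> (I k \<union> B k) (w k) x (w k x)\<bar> \<le> C" if "x \<in> I k" for k x
    using w(3)[OF that] C(2)[OF w(2)] that by simp

  \<comment> \<open>The cone condition on \<open>A\<close> in \<open>discrete_subsolution_below_cone\<close>, solved for \<open>A\<close>; the
    additional 1 makes it strict.\<close>
  define A0 where "A0 = (\<lambda>\<beta>. (C + 1) / ((1 - \<beta> / \<alpha>) * D powr (\<beta> - \<alpha>)))"
  have A0: "0 \<le> A0 \<beta>" "\<And>A. A0 \<beta> \<le> A \<Longrightarrow> C < A * (1 - \<beta> / \<alpha>) * D powr (\<beta> - \<alpha>)"
    if "0 < \<beta>" "\<beta> < \<alpha>" for \<beta>
  proof -
    have pos: "0 < (1 - \<beta> / \<alpha>) * D powr (\<beta> - \<alpha>)" using that D(1) by simp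
    then show "0 \<le> A0 \<beta>" unfolding A0_def using C(1) by (intro divide_nonneg_nonneg) auto
    fix A assume "A0 \<beta> \<le> A"
    then have "C + 1 \<le> A * ((1 - \<beta> / \<alpha>) * D powr (\<beta> - \<alpha>))"
      using pos by (simp add: A0_def pos_divide_le_eq)
    then show "C < A * (1 - \<beta> / \<alpha>) * D powr (\<beta> - \<alpha>)" by (simp add: mult.assoc)
  qed
  have modulus: "\<bar>w k x - w k y\<bar> \<le> \<epsilon> + A * dist x y powr \<beta>"
    if \<beta>: "0 < \<beta>" "\<beta> < \<alpha>" and "0 \<le> \<epsilon>" "A0 \<beta> \<le> A"
      and gmod: "\<And>a b. a \<in> frontier \<Omega> \<Longrightarrow> b \<in> frontier \<Omega> \<Longrightarrow> \<bar>g a - g b\<bar> \<le> \<epsilon> + A * dist a b powr \<beta>"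
      and xy: "x \<in> I k \<union> B k" "y \<in> I k \<union> B k" for \<beta> \<epsilon> A k x y
  proof (rule discrete_global_modulus[OF finX disj IB(3) \<beta> \<alpha>(2) _ \<open>0 \<le> \<epsilon>\<close> _ A0(2)[OF \<beta> \<open>A0 \<beta> \<le> A\<close>] fw _ xy])
    show "\<bar>w k a - w k b\<bar> \<le> \<epsilon> + A * dist a b powr \<beta>" if "a \<in> B k" "b \<in> B k" for a b
      using gmod[of a b] w(1) that IB(2)[of k] by auto
  qed (use A0(1)[OF \<beta>] \<open>A0 \<beta> \<le> A\<close> D(2) Xcl in auto)
  \<comment> \<open>Any exponent below \<open>\<alpha>\<close> would do for the equicontinuity; \<open>\<alpha> / 2\<close> is one.\<close>
  have modulus_ex: "\<exists>A\<ge>0. \<forall>k. \<forall>x\<in>I k \<union> B k. \<forall>y\<in>I k \<union> B k.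
      \<bar>w k x - w k y\<bar> \<le> \<epsilon> + A * dist x y powr (\<alpha> / 2)" if "0 < \<epsilon>" for \<epsilon>
  proof -
    obtain A where A: "0 \<le> A"
      "\<And>a b. a \<in> frontier \<Omega> \<Longrightarrow> b \<in> frontier \<Omega> \<Longrightarrow> \<bar>g a - g b\<bar> \<le> \<epsilon> + A * dist a b powr (\<alpha> / 2)"
      using compact_continuous_holder_modulus[OF cfr g \<open>0 < \<epsilon>\<close>, of "\<alpha> / 2"] \<alpha>(1) by auto
    have h: "0 < \<alpha> / 2" "\<alpha> / 2 < \<alpha>" using \<alpha>(1) by auto
    have "\<bar>g a - g b\<bar> \<le> \<epsilon> + (A + A0 (\<alpha> / 2)) * dist a b powr (\<alpha> / 2)"
      if "a \<in> frontier \<Omega>" "b \<in> frontier \<Omega>" for a b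
    proof -
      have "A * dist a b powr (\<alpha> / 2) \<le> (A + A0 (\<alpha> / 2)) * dist a b powr (\<alpha> / 2)"
        using A0(1)[OF h] by (intro mult_right_mono) auto
      then show ?thesis using A(2)[OF that] by linarith
    qed
    then have "\<forall>k. \<forall>x\<in>I k \<union> B k. \<forall>y\<in>I k \<union> B k.
      \<bar>w k x - w k y\<bar> \<le> \<epsilon> + (A + A0 (\<alpha> / 2)) * dist x y powr (\<alpha> / 2)"
      using modulus[OF h, of \<epsilon> "A + A0 (\<alpha> / 2)"] \<open>0 < \<epsilon>\<close> A(1) by (simp add: less_imp_le)
    then show ?thesis using A(1) A0(1)[OF h] by (intro exI[of _ "A + A0 (\<alpha> / 2)"]) simp
  qed
  have eqc: "\<exists>\<delta>>0. \<forall>k. \<forall>x\<in>I k \<union> B k. \<forall>y\<in>I k \<union> B k. dist x y < \<delta> \<longrightarrow> \<bar>w k x - w k y\<bar> < \<epsilon>"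
    if "0 < \<epsilon>" for \<epsilon>
  proof -
    obtain A where A: "0 \<le> A" "\<And>k x y. x \<in> I k \<union> B k \<Longrightarrow> y \<in> I k \<union> B k \<Longrightarrow>
        \<bar>w k x - w k y\<bar> \<le> \<epsilon> / 2 + A * dist x y powr (\<alpha> / 2)"
      using modulus_ex[of "\<epsilon> / 2"] \<open>0 < \<epsilon>\<close> by auto
    obtain \<delta> where \<delta>: "0 < \<delta>" "\<And>t. 0 \<le> t \<Longrightarrow> t < \<delta> \<Longrightarrow> A * t powr (\<alpha> / 2) < \<epsilon> / 2"
      using holder_modulus_imp_small[OF A(1), of "\<epsilon> / 2" "\<alpha> / 2"] \<open>0 < \<epsilon>\<close> \<alpha>(1) by auto
    have "\<bar>w k x - w k y\<bar> < \<epsilon>" if "x \<in> I k \<union> B k" "y \<in> I k \<union> B k" "dist x y < \<delta>" for k x y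
      using A(2)[OF that(1,2)] \<delta>(2)[OF zero_le_dist that(3)] by linarith
    then show ?thesis using \<delta>(1) by blast
  qed

  obtain r u where r: "strict_mono r" and u: "\<And>x. x \<in> closure \<Omega> \<Longrightarrow> (\<lambda>k. w (r k) (p (r k) x)) \<longlonglongrightarrow> u x"
  proof (rule equicontinuous_convergent_subsequence[where S = "closure \<Omega>" and v = "\<lambda>k x. w k (p k x)" and K = K])
    show "\<bar>w k (p k x)\<bar> \<le> K" if "x \<in> closure \<Omega>" for k x using w(2)[OF p(1)[OF that]] .
    fix \<epsilon> :: real assume "0 < \<epsilon>"
    from eqc[OF this] obtain \<delta> where \<delta>: "0 < \<delta>"
      "\<forall>k. \<forall>x\<in>I k \<union> B k. \<forall>y\<in>I k \<union> B k. dist x y < \<delta> \<longrightarrow> \<bar>w k x - w k y\<bar> < \<epsilon>" by (elim exE conjE)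
    have "\<forall>\<^sub>F k in sequentially. \<bar>w k (p k x) - w k (p k y)\<bar> < \<epsilon>"
      if xy: "x \<in> closure \<Omega>" "y \<in> closure \<Omega>" "dist x y < \<delta>" for x y
    proof -
      have "\<forall>\<^sub>F k in sequentially. dist (p k x) (p k y) < \<delta>"
        using tendsto_dist[OF p(3)[OF xy(1)] p(3)[OF xy(2)]] xy(3) by (rule order_tendstoD)
      then show ?thesis
        by eventually_elim (use \<delta>(2) p(1)[OF xy(1)] p(1)[OF xy(2)] in blast)
    qed
    then show "\<exists>\<delta>>0. \<forall>x\<in>closure \<Omega>. \<forall>y\<in>closure \<Omega>. dist x y < \<delta> \<longrightarrow>
        (\<forall>\<^sub>F k in sequentially. \<bar>w k (p k x) - w k (p k y)\<bar> < \<epsilon>)"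
      using \<delta>(1) by blast
  qed blast
  have pr: "(\<lambda>k. p (r k) x) \<longlonglongrightarrow> x" if "x \<in> closure \<Omega>" for x
    using LIMSEQ_subseq_LIMSEQ[OF p(3)[OF that] r] by (simp add: o_def)
  have pass: "\<bar>u x - u y\<bar> \<le> \<epsilon> + A * dist x y powr \<beta>"
    if xy: "x \<in> closure \<Omega>" "y \<in> closure \<Omega>" and "0 < \<beta>"
      and le: "\<forall>\<^sub>F k in sequentially. \<bar>w (r k) (p (r k) x) - w (r k) (p (r k) y)\<bar>
        \<le> \<epsilon> + A * dist (p (r k) x) (p (r k) y) powr \<beta>" for x y \<epsilon> A \<beta>
    by (rule holder_modulus_limit[OF pr[OF xy(1)] pr[OF xy(2)] u[OF xy(1)] u[OF xy(2)] \<open>0 < \<beta>\<close> le])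
  have pass_closure: "\<bar>u x - u y\<bar> \<le> \<epsilon> + A * dist x y powr \<beta>"
    if "x \<in> closure \<Omega>" "y \<in> closure \<Omega>" "0 < \<beta>"
      and "\<And>k x y. x \<in> I k \<union> B k \<Longrightarrow> y \<in> I k \<union> B k \<Longrightarrow> \<bar>w k x - w k y\<bar> \<le> \<epsilon> + A * dist x y powr \<beta>"
    for x y \<epsilon> A \<beta>
    by (rule pass[OF that(1-3)]) (intro always_eventually allI that(4) p(1) that(1,2))

  have "continuous_on (closure \<Omega>) u"
    unfolding continuous_on_iff
  proof (intro ballI allI impI)
    fix x and \<epsilon> :: real assume x: "x \<in> closure \<Omega>" and "0 < \<epsilon>"
    obtain A where A: "0 \<le> A" "\<And>k x y. x \<in> I k \<union> B k \<Longrightarrow> y \<in> I k \<union> B k \<Longrightarrow>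
        \<bar>w k x - w k y\<bar> \<le> \<epsilon> / 2 + A * dist x y powr (\<alpha> / 2)"
      using modulus_ex[of "\<epsilon> / 2"] \<open>0 < \<epsilon>\<close> by auto
    obtain \<delta> where \<delta>: "0 < \<delta>" "\<And>t. 0 \<le> t \<Longrightarrow> t < \<delta> \<Longrightarrow> A * t powr (\<alpha> / 2) < \<epsilon> / 2"
      using holder_modulus_imp_small[OF A(1), of "\<epsilon> / 2" "\<alpha> / 2"] \<open>0 < \<epsilon>\<close> \<alpha>(1) by auto
    have "dist (u y) (u x) < \<epsilon>" if y: "y \<in> closure \<Omega>" "dist y x < \<delta>" for y
    proof -
      have "\<bar>u y - u x\<bar> \<le> \<epsilon> / 2 + A * dist y x powr (\<alpha> / 2)"
        using \<alpha>(1) A(2) by (intro pass_closure y x) auto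
      then show ?thesis
        using \<delta>(2)[OF zero_le_dist y(2)] unfolding dist_real_def by linarith
    qed
    then show "\<exists>\<delta>>0. \<forall>y\<in>closure \<Omega>. dist y x < \<delta> \<longrightarrow> dist (u y) (u x) < \<epsilon>"
      using \<delta>(1) by blast
  qed
  note cont = this
  have "viscosity_subsolution \<alpha> \<Omega> f u"
  proof (rule discrete_limit_subsolution[where I = "\<lambda>k. I (r k)" and B = "\<lambda>k. B (r k)"
        and p = "\<lambda>k. p (r k)" and v = "\<lambda>k. w (r k)"])
    show "\<exists>\<delta>>0. \<forall>k. \<forall>x\<in>I (r k) \<union> B (r k). \<forall>y\<in>I (r k) \<union> B (r k).
        dist x y < \<delta> \<longrightarrow> \<bar>w (r k) x - w (r k) y\<bar> < \<epsilon>" if "0 < \<epsilon>" for \<epsilon>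
      using eqc[OF that] by blast
    show "f (w (r k) x) \<le> discrete_L \<alpha> (I (r k) \<union> B (r k)) (w (r k)) x (w (r k) x)"
      if "x \<in> I (r k)" for k x
      using w(3)[OF that] by simp
  qed (fact \<Omega> \<alpha> f fin IB p pr u cont)+
  moreover have "viscosity_supersolution \<alpha> \<Omega> f u"
  proof (rule viscosity_supersolution_uminus, rule discrete_limit_subsolution[where I = "\<lambda>k. I (r k)"
        and B = "\<lambda>k. B (r k)" and p = "\<lambda>k. p (r k)" and v = "\<lambda>k x. - w (r k) x"])
    show "\<exists>\<delta>>0. \<forall>k. \<forall>x\<in>I (r k) \<union> B (r k). \<forall>y\<in>I (r k) \<union> B (r k).
        dist x y < \<delta> \<longrightarrow> \<bar>- w (r k) x - (- w (r k) y)\<bar> < \<epsilon>" if "0 < \<epsilon>" for \<epsilon>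
      using eqc[OF that] by (simp add: abs_minus_commute) blast
    show "- f (- (- w (r k) x)) \<le> discrete_L \<alpha> (I (r k) \<union> B (r k)) (\<lambda>x. - w (r k) x) x (- w (r k) x)"
      if "x \<in> I (r k)" for k x
    proof -
      have "I (r k) \<union> B (r k) - {x} \<noteq> {}" using IB(3)[of "r k"] disj[of "r k"] that by auto
      then show ?thesis using w(3)[OF that] finX by (simp add: discrete_L_uminus)
    qed
    show "continuous_on UNIV (\<lambda>t. - f (- t))"
      by (intro continuous_on_minus continuous_on_compose2[OF f(1)]) auto
    show "(\<lambda>k. - w (r k) (p (r k) x)) \<longlonglongrightarrow> - u x" if "x \<in> closure \<Omega>" for x
      by (intro tendsto_minus u that)
    show "continuous_on (closure \<Omega>) (\<lambda>x. - u x)" by (intro continuous_on_minus cont)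
  qed (fact \<Omega> \<alpha> fin IB p pr)+
  ultimately have sol: "viscosity_solution \<alpha> \<Omega> f u" by (simp add: viscosity_solution_def)

  have bdry: "u x = g x" if x: "x \<in> frontier \<Omega>" for x
  proof (rule LIMSEQ_unique)
    show "(\<lambda>k. w (r k) (p (r k) x)) \<longlonglongrightarrow> u x" by (rule u[OF frcl[OF x]])
    have "(\<lambda>k. g (p (r k) x)) \<longlonglongrightarrow> g x"
      using p(2)[OF x] IB(2)
      by (intro continuous_on_tendsto_compose[OF g pr[OF frcl[OF x]] x] always_eventually) blast
    then show "(\<lambda>k. w (r k) (p (r k) x)) \<longlonglongrightarrow> g x" using w(1)[OF p(2)[OF x]] by simp
  qed

  have local: "locally_holder_on \<gamma> \<Omega> u"
    if \<gamma>: "0 < \<gamma>" and cone: "\<And>d. 0 < d \<Longrightarrow> \<exists>A. \<forall>k. \<forall>x0\<in>I k \<union> B k.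
        (\<forall>b\<in>frontier \<Omega>. d \<le> dist b x0) \<longrightarrow> (\<forall>x\<in>I k \<union> B k. w k x \<le> w k x0 + A * dist x x0 powr \<gamma>)" for \<gamma>
    unfolding locally_holder_on_def
  proof (intro allI impI)
    fix \<omega> assume \<omega>: "compact (closure \<omega>) \<and> closure \<omega> \<subseteq> \<Omega>"
    have "closure \<omega> \<inter> frontier \<Omega> = {}" using \<omega> \<Omega>(2) by (auto simp: frontier_def interior_open)
    then obtain d where d: "0 < d" "\<And>x b. x \<in> closure \<omega> \<Longrightarrow> b \<in> frontier \<Omega> \<Longrightarrow> d \<le> dist x b"
      using separate_compact_closed[of "closure \<omega>" "frontier \<Omega>"] \<omega> by auto
    from cone[OF half_gt_zero[OF d(1)]] obtain A where A: "\<forall>k. \<forall>x0\<in>I k \<union> B k.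
        (\<forall>b\<in>frontier \<Omega>. d / 2 \<le> dist b x0) \<longrightarrow> (\<forall>x\<in>I k \<union> B k. w k x \<le> w k x0 + A * dist x x0 powr \<gamma>)"
      by (elim exE)
    \<comment> \<open>Grid points near \<open>x\<close> lose at most half of the distance to the frontier.\<close>
    have far: "\<forall>\<^sub>F k in sequentially. \<forall>b\<in>frontier \<Omega>. d / 2 \<le> dist b (p (r k) x)" if x: "x \<in> \<omega>" for x
    proof -
      have xc: "x \<in> closure \<omega>" "x \<in> closure \<Omega>" using x \<omega> closure_subset[of \<omega>] closure_subset[of \<Omega>] by auto
      have "\<forall>\<^sub>F k in sequentially. dist (p (r k) x) x < d / 2"
        by (rule tendstoD[OF pr[OF xc(2)] half_gt_zero[OF d(1)]])
      then show ?thesis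
      proof eventually_elim
        case (elim k)
        show ?case
        proof
          fix b assume "b \<in> frontier \<Omega>"
          from d(2)[OF xc(1) this] elim show "d / 2 \<le> dist b (p (r k) x)"
            using dist_triangle[of x b "p (r k) x"] by (simp add: dist_commute)
        qed
      qed
    qed
    have "\<bar>u x - u y\<bar> \<le> 0 + A * dist x y powr \<gamma>" if xy: "x \<in> \<omega>" "y \<in> \<omega>" for x y
    proof (rule pass[OF _ _ \<gamma>])
      show c: "x \<in> closure \<Omega>" "y \<in> closure \<Omega>"
        using xy \<omega> closure_subset[of \<omega>] closure_subset[of \<Omega>] by auto
      show "\<forall>\<^sub>F k in sequentially. \<bar>w (r k) (p (r k) x) - w (r k) (p (r k) y)\<bar>
          \<le> 0 + A * dist (p (r k) x) (p (r k) y) powr \<gamma>"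
        using far[OF xy(1)] far[OF xy(2)]
      proof eventually_elim
        case (elim k)
        have "w (r k) (p (r k) x) \<le> w (r k) (p (r k) y) + A * dist (p (r k) x) (p (r k) y) powr \<gamma>"
          "w (r k) (p (r k) y) \<le> w (r k) (p (r k) x) + A * dist (p (r k) y) (p (r k) x) powr \<gamma>"
          using A elim p(1)[OF c(1)] p(1)[OF c(2)] by blast+
        then show ?case by (simp add: dist_commute abs_le_iff)
      qed
    qed
    then show "holder_on \<gamma> \<omega> u" unfolding holder_on_def by auto
  qed
  have far_bound: "w k b \<le> w k x0 + A * dist b x0 powr \<gamma>"
    if "0 < \<gamma>" "0 < d" "2 * K / d powr \<gamma> \<le> A" "x0 \<in> I k \<union> B k" "b \<in> B k" "\<forall>b\<in>frontier \<Omega>. d \<le> dist b x0"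
    for k x0 b A \<gamma> d
  proof -
    have "\<bar>w k b\<bar> \<le> K" "\<bar>w k x0\<bar> \<le> K" using w(2) that by auto
    then have "w k b - w k x0 \<le> 2 * K / d powr \<gamma> * d powr \<gamma>" using \<open>0 < d\<close> by simp
    also have "\<dots> \<le> A * dist b x0 powr \<gamma>"
    proof (rule mult_mono)
      show "d powr \<gamma> \<le> dist b x0 powr \<gamma>" using that IB(2)[of k] by (intro powr_mono2) auto
      have "0 \<le> 2 * K / d powr \<gamma>" using K by simp
      then show "0 \<le> A" using that(3) by linarith
    qed (use that in auto)
    finally show ?thesis by simp
  qed

  have loc: "locally_holder_on \<beta> \<Omega> u" if \<beta>: "0 < \<beta>" "\<beta> < \<alpha>" for \<beta>
  proof (rule local[OF \<beta>(1)])
    fix d :: real assume d: "0 < d"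
    define A where "A = A0 \<beta> + 2 * K / d powr \<beta>"
    have A: "A0 \<beta> \<le> A" "2 * K / d powr \<beta> \<le> A" using A0(1)[OF \<beta>] K by (auto simp: A_def)
    have "w k x \<le> w k x0 + A * dist x x0 powr \<beta>"
      if x0: "x0 \<in> I k \<union> B k" "\<forall>b\<in>frontier \<Omega>. d \<le> dist b x0" and x: "x \<in> I k \<union> B k" for k x0 x
    proof (rule discrete_subsolution_below_cone[OF finX x0(1) order_refl \<beta> \<alpha>(2) _ _ A0(2)[OF \<beta> A(1)] _ _ x])
      show "- C \<le> discrete_L \<alpha> (I k \<union> B k) (w k) z (w k z)" if "z \<in> I k" for z
        using fw[OF that] by (simp add: abs_le_iff)
      show "w k b \<le> w k x0 + A * dist b x0 powr \<beta>" if "b \<in> B k" for b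
        by (rule far_bound[OF \<beta>(1) d A(2) x0(1) that x0(2)])
    qed (use A0(1)[OF \<beta>] A(1) D(2) Xcl x0 in auto)
    then show "\<exists>A. \<forall>k. \<forall>x0\<in>I k \<union> B k.
        (\<forall>b\<in>frontier \<Omega>. d \<le> dist b x0) \<longrightarrow> (\<forall>x\<in>I k \<union> B k. w k x \<le> w k x0 + A * dist x x0 powr \<beta>)"
      by blast
  qed
  have crit: "locally_holder_on \<alpha> \<Omega> u" if "\<alpha> < 1" and f0: "\<And>t. 0 \<le> f t"
  proof (rule local[OF \<alpha>(1)])
    fix d :: real assume d: "0 < d"
    define A where "A = 2 * K / d powr \<alpha>"
    have A: "0 < A" "2 * K / d powr \<alpha> \<le> A" using K d by (auto simp: A_def)
    have "w k x \<le> w k x0 + A * dist x x0 powr \<alpha>"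
      if x0: "x0 \<in> I k \<union> B k" "\<forall>b\<in>frontier \<Omega>. d \<le> dist b x0" and x: "x \<in> I k \<union> B k" for k x0 x
    proof (rule discrete_nonneg_below_critical_cone[OF finX x0(1) order_refl \<alpha>(1) \<open>\<alpha> < 1\<close> A(1) _ _ x])
      show "0 \<le> discrete_L \<alpha> (I k \<union> B k) (w k) z (w k z)" if "z \<in> I k" for z
        using w(3)[OF that] f0 by simp
      show "w k b \<le> w k x0 + A * dist b x0 powr \<alpha>" if "b \<in> B k" for b
        by (rule far_bound[OF \<alpha>(1) d A(2) x0(1) that x0(2)])
    qed
    then show "\<exists>A. \<forall>k. \<forall>x0\<in>I k \<union> B k.
        (\<forall>b\<in>frontier \<Omega>. d \<le> dist b x0) \<longrightarrow> (\<forall>x\<in>I k \<union> B k. w k x \<le> w k x0 + A * dist x x0 powr \<alpha>)"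
      by blast
  qed
  have glob: "holder_on \<beta> (closure \<Omega>) u" if \<beta>: "0 < \<beta>" "\<beta> < \<alpha>" and gh: "holder_on \<beta> (frontier \<Omega>) g" for \<beta>
  proof -
    obtain H where H: "\<And>a b. a \<in> frontier \<Omega> \<Longrightarrow> b \<in> frontier \<Omega> \<Longrightarrow> \<bar>g a - g b\<bar> \<le> H * dist a b powr \<beta>"
      using gh unfolding holder_on_def by blast
    define A where "A = max H (A0 \<beta>)"
    have "\<bar>g a - g b\<bar> \<le> 0 + A * dist a b powr \<beta>" if "a \<in> frontier \<Omega>" "b \<in> frontier \<Omega>" for a b
    proof -
      have "H * dist a b powr \<beta> \<le> A * dist a b powr \<beta>" by (intro mult_right_mono) (auto simp: A_def)
      then show ?thesis using H[OF that] by linarith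
    qed
    then have "\<bar>u x - u y\<bar> \<le> 0 + A * dist x y powr \<beta>" if "x \<in> closure \<Omega>" "y \<in> closure \<Omega>" for x y
      using that \<beta> by (intro pass_closure modulus) (auto simp: A_def)
    then show ?thesis unfolding holder_on_def by auto
  qed
  show ?thesis using that[OF sol bdry loc glob crit] by blast
qed

theorem theorem1p1:
  fixes \<Omega> :: "(real ^ 'n::finite) set" and \<alpha> :: real
    and f :: "real \<Rightarrow> real" and g :: "real ^ 'n \<Rightarrow> real"
  assumes "bounded \<Omega>" and "open \<Omega>"
    and "0 < \<alpha>" and "\<alpha> \<le> 1"
    and "continuous_on UNIV f" and "mono f"
    and "continuous_on (frontier \<Omega>) g"
  shows "\<exists>u :: real ^ 'n \<Rightarrow> real.
    viscosity_solution \<alpha> \<Omega> f u \<and>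
    (\<forall>x\<in>frontier \<Omega>. u x = g x) \<and>
    (\<forall>\<beta>. 0 < \<beta> \<and> \<beta> < \<alpha> \<longrightarrow> locally_holder_on \<beta> \<Omega> u) \<and>
    (\<forall>\<beta>. 0 < \<beta> \<and> \<beta> < \<alpha> \<longrightarrow> holder_on \<beta> (frontier \<Omega>) g \<longrightarrow> holder_on \<beta> (closure \<Omega>) u) \<and>
    (\<alpha> < 1 \<and> (\<forall>t. 0 \<le> f t) \<longrightarrow> locally_holder_on \<alpha> \<Omega> u)"
proof (cases "\<Omega> = {}")
  case True
  then show ?thesis
    by (intro exI[of _ g])
      (auto simp: viscosity_solution_def viscosity_subsolution_def viscosity_supersolution_def
        usc_on_def lsc_on_def locally_holder_on_def holder_on_def)
next
  case False
  obtain u where "viscosity_solution \<alpha> \<Omega> f u" "\<And>x. x \<in> frontier \<Omega> \<Longrightarrow> u x = g x"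
    and "\<And>\<beta>. 0 < \<beta> \<Longrightarrow> \<beta> < \<alpha> \<Longrightarrow> locally_holder_on \<beta> \<Omega> u"
    and "\<And>\<beta>. 0 < \<beta> \<Longrightarrow> \<beta> < \<alpha> \<Longrightarrow> holder_on \<beta> (frontier \<Omega>) g \<Longrightarrow> holder_on \<beta> (closure \<Omega>) u"
    and "\<alpha> < 1 \<Longrightarrow> (\<And>t. 0 \<le> f t) \<Longrightarrow> locally_holder_on \<alpha> \<Omega> u"
    using viscosity_solution_exists[OF assms(1,2) False assms(3-7)] by blast
  then show ?thesis by (intro exI[of _ u]) simp
qed

end
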